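(* Let $m,n\ge1$ be integers, let $\vec w=(w_1,\dots,w_m)\in A_{\vec 1}$ be an $m$-tuple of weights on $\mathbb{R}^n$, let $\nu=w_1^{1/m}\cdots w_m^{1/m}$, and let $v$ be a weight on $\mathbb{R}^n$ satisfying $\nu v^{1/m}\in A_\infty$. Then there is a finite constant $C$ (independent of $\vec f$) such that for all $\vec f=(f_1,\dots,f_m)$ with $f_i\in L^1(w_i)$, $i=1,\dots,m$, $$\left\| \frac{\mathcal M(\vec f\,)}{v}\right\|_{L^{\frac1m,\infty}(\nu v^{1/m})}\le C\prod_{i=1}^m\|f_i\|_{L^1(w_i)}.$$
   Context: A weight is a nonnegative locally integrable function on $\mathbb{R}^n$ that is positive a.e. $A_\infty$ is the usual Muckenhoupt class on $\mathbb{R}^n$. The multilinear condition $\vec w=(w_1,\dots,w_m)\in A_{\vec 1}$ means, with $\nu=\prod_{i=1}^m w_i^{1/m}$, $$\sup_Q\Big(\frac1{|Q|}\int_Q\nu\Big)^{m}\prod_{i=1}^m\Big(\inf_Q w_i\Big)^{-1}<\infty,$$ where the supremum is over all cubes $Q\subset\mathbb{R}^n$ and $\inf_Q$ is the essential infimum over $Q$. The multi(sub)linear maximal function is $\mathcal M(\vec f\,)(x)=\sup_{Q\ni x}\prod_{i=1}^m\frac1{|Q|}\int_Q|f_i(y_i)|\,dy_i$, the supremum being over all cubes $Q$ containing $x$. $\|f\|_{L^1(w)}=\int_{\mathbb{R}^n}|f|\,w\,dx$. For $0<p<\infty$ and a nonnegative function $\mu$ on $\mathbb{R}^n$, $\|g\|_{L^{p,\infty}(\mu)}=\sup_{\lambda>0}\lambda\,\big(\mu(\{x:|g(x)|>\lambda\})\big)^{1/p}$,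 where $\mu(E)=\int_E\mu(x)\,dx$. *)

theory Defs
  imports "HOL-Analysis.Analysis"
begin

text \<open>Cubes are closed, nondegenerate and have sides parallel to the coordinate axes.\<close>

definition cubes :: "(real^'n) set set" where
  "cubes = {cbox a (a + vec r) | a r. 0 < r}"

definition avg :: "(real^'n) set \<Rightarrow> (real^'n \<Rightarrow> ennreal) \<Rightarrow> ennreal" where
  "avg Q g = (\<integral>\<^sup>+x\<in>Q. g x \<partial>lebesgue) / emeasure lebesgue Q"

definition ess_inf_on :: "(real^'n) set \<Rightarrow> (real^'n \<Rightarrow> ennreal) \<Rightarrow> ennreal" where
  "ess_inf_on Q g = Sup {c. AE x in lebesgue. x \<in> Q \<longrightarrow> c \<le> g x}"

text \<open>Powers of extended nonnegative reals; only used with exponent \<open>a > 0\<close>.\<close>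

definition ennreal_powr :: "ennreal \<Rightarrow> real \<Rightarrow> ennreal" where
  "ennreal_powr t a = (if t = \<infinity> then \<infinity> else ennreal (enn2real t powr a))"

definition weight :: "(real^'n \<Rightarrow> real) \<Rightarrow> bool" where
  "weight w \<longleftrightarrow>
     (\<forall>x. 0 \<le> w x) \<and>
     (\<forall>K. compact K \<longrightarrow> w absolutely_integrable_on K) \<and>
     (AE x in lebesgue. 0 < w x)"

text \<open>
  The Muckenhoupt classes \<open>A\<^sub>p\<close> for \<open>1 < p < \<infinity>\<close>; the exponent \<open>- 1 / (p - 1)\<close> is \<open>1 - p'\<close>.
  Since \<open>A\<^sub>1\<close> is contained in every \<open>A\<^sub>p\<close>, it can be left out of the union defining \<open>A\<^sub>\<infinity>\<close>.
\<close>

definition Muckenhoupt_A :: "real \<Rightarrow> (real^'n \<Rightarrow> real) \<Rightarrow> bool" where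
  "Muckenhoupt_A p w \<longleftrightarrow> weight w \<and>
     (SUP Q\<in>cubes. avg Q (\<lambda>x. ennreal (w x)) *
        ennreal_powr (avg Q (\<lambda>x. ennreal (w x powr (- 1 / (p - 1))))) (p - 1)) < \<infinity>"

definition Muckenhoupt_A_infinity :: "(real^'n \<Rightarrow> real) \<Rightarrow> bool" where
  "Muckenhoupt_A_infinity w \<longleftrightarrow> (\<exists>p>1. Muckenhoupt_A p w)"

text \<open>An \<open>m\<close>-tuple is a function on \<open>nat\<close> of which only the values on \<open>{1..m}\<close> matter.\<close>

definition geom_mean :: "nat \<Rightarrow> (nat \<Rightarrow> real^'n \<Rightarrow> real) \<Rightarrow> real^'n \<Rightarrow> real" where
  "geom_mean m w x = (\<Prod>i=1..m. w i x powr (1 / real m))"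

text \<open>
  For weights no product \<open>0 * \<infinity>\<close> occurs below: averages of weights lie in \<open>(0, \<infinity>)\<close> and
  essential infima in \<open>[0, \<infinity>)\<close>, where \<open>inverse 0 = \<infinity>\<close>.
\<close>

definition multilinear_A1 :: "nat \<Rightarrow> (nat \<Rightarrow> real^'n \<Rightarrow> real) \<Rightarrow> bool" where
  "multilinear_A1 m w \<longleftrightarrow> (\<forall>i\<in>{1..m}. weight (w i)) \<and>
     (SUP Q\<in>cubes. avg Q (\<lambda>x. ennreal (geom_mean m w x)) ^ m *
        (\<Prod>i=1..m. inverse (ess_inf_on Q (\<lambda>x. ennreal (w i x))))) < \<infinity>"

definition multi_maximal ::
    "nat \<Rightarrow> (nat \<Rightarrow> real^'n \<Rightarrow> 'b::real_normed_vector) \<Rightarrow> real^'n \<Rightarrow> ennreal" where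
  "multi_maximal m f x =
     (SUP Q\<in>{Q \<in> cubes. x \<in> Q}. \<Prod>i=1..m. avg Q (\<lambda>y. ennreal (norm (f i y))))"

definition L1_norm :: "(real^'n \<Rightarrow> real) \<Rightarrow> (real^'n \<Rightarrow> 'b::real_normed_vector) \<Rightarrow> ennreal" where
  "L1_norm w f = (\<integral>\<^sup>+x. ennreal (norm (f x) * w x) \<partial>lebesgue)"

definition L1_space :: "(real^'n \<Rightarrow> real) \<Rightarrow> (real^'n \<Rightarrow> 'b::real_normed_vector) set" where
  "L1_space w = {f \<in> borel_measurable lebesgue. L1_norm w f < \<infinity>}"

text \<open>
  The weak quasinorm of a function \<open>g\<close> with values in \<open>[0, \<infinity>]\<close>, so that it applies
  directly to maximal functions.
\<close>

definition weak_norm :: "real \<Rightarrow> (real^'n \<Rightarrow> real) \<Rightarrow> (real^'n \<Rightarrow> ennreal) \<Rightarrow> ennreal" where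
  "weak_norm p \<mu> g =
     (SUP l\<in>{0<..}. ennreal l *
        ennreal_powr (\<integral>\<^sup>+x\<in>{x. ennreal l < g x}. ennreal (\<mu> x) \<partial>lebesgue) (1 / p))"

end

(*
  Write F_i for the measure |f_i| w_i dx, N for nu dx, M for nu V dx with V = v^(1/m).  The condition
  A_1 bounds the product of the averages of the f_i over Q by a constant times the product of
  the F_i(Q) / N(Q), so after taking m-th roots it suffices to bound the M-measure of the points x
  lying in a cube Q with V(x) N(Q) < G(Q), where G(Q) is a multiple of the geometric mean of the
  F_i(Q).  By AM-GM the sum of G over disjoint cubes is at most its value on the whole space.

  Pass to dyadic cubes and sort them by the integer l with M(Q) of size 2^l G(Q).  A Vitali argument
  bounds the M-measure of the union of the cubes of index l by 2^l, up to a constant.  In such a cube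
  only the points where V < C 2^(-l) M(Q)/N(Q) matter, and they occupy at most a fraction
  2^(-l(1+e)) of the M-measure: for one cube because N decays like a power of Lebesgue measure
  (A_1) while M controls a power of Lebesgue measure (A_p), and for nested cubes by induction along
  principal cubes, across which M(Q)/N(Q) grows geometrically.  The resulting series over l is geometric.
*)
theory Submission
  imports Defs
begin

section \<open>Dyadic cubes\<close>

text \<open>The threshold in V(x) N(Q) < G(Q) depends on the point, so a covering lemma alone leaves
  cubes where M(Q) is far larger than G(Q). For these Vitali loses 2^l, and a fraction of merely
  2^(-l) would make every level contribute equally; the surplus e > 0 makes the sum converge. It
  comes from using the bound V < s M(Q)/N(Q) twice: once to see that the set is small, and once,
  after improving its N-measure, to return to M. Hence e = d/p, with d the decay exponent of N and p
  the exponent of the A_p condition on \<nu> V. The regularity assumptions concern \<nu> and \<nu>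
  V, not v separately, so N and M are compared through Lebesgue measure: A_1 ties it to N, A_p ties
  it to M. A single dyadic lattice suffices because G is monotone: it is evaluated on an enlargement
  of the dyadic cube, and only the loss in N(Q) has to be paid for. The combinatorial estimates are
  proved for finite families, where maximal cubes exist and inductions on cardinality end. Their
  constants do not depend on the family, so monotone limits can be taken afterwards.\<close>

definition dyadic_cube :: "int \<Rightarrow> real^'n \<Rightarrow> (real^'n) set" where
  "dyadic_cube j x = {y. \<forall>i. \<lfloor>2 powi j * y$i\<rfloor> = \<lfloor>2 powi j * x$i\<rfloor>}"

definition dyadics :: "(real^'n) set set" where
  "dyadics = {dyadic_cube j x | j x. True}"

lemma mem_dyadic_cube_self [simp]: "x \<in> dyadic_cube j x"
  by (simp add: dyadic_cube_def)

lemma dyadic_cube_in_dyadics [simp]: "dyadic_cube j x \<in> dyadics"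
  by (auto simp: dyadics_def)

lemma dyadic_cube_eq: "y \<in> dyadic_cube j x \<Longrightarrow> dyadic_cube j y = dyadic_cube j x"
  by (auto simp: dyadic_cube_def)

text \<open>Larger indices mean smaller cubes. Flooring at the coarser scale amounts to integer
  division by \<open>2 ^ d\<close> of the floor at the finer scale, so equal fine floors force equal
  coarse floors.\<close>

lemma dyadic_cube_antimono:
  assumes "j \<le> k"
  shows "dyadic_cube k x \<subseteq> dyadic_cube j x"
proof
  fix y assume y: "y \<in> dyadic_cube k x"
  define d where "d = nat (k - j)"
  have k: "k = j + int d" using assms by (simp add: d_def)
  have "\<lfloor>2 powi j * z\<rfloor> = \<lfloor>2 powi k * z\<rfloor> div 2 ^ d" for z :: real
  proof -
    have "2 powi j * z = 2 powi k * z / real_of_int (2 ^ d)"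
      by (simp add: k power_int_add)
    then show ?thesis
      using floor_divide_real_eq_div[of "2 ^ d" "2 powi k * z"] by simp
  qed
  then show "y \<in> dyadic_cube j x"
    using y by (simp add: dyadic_cube_def)
qed

text \<open>A cube may be named by any of its points. Naming both by a common point leaves only the
  generations to be compared.\<close>

lemma dyadics_nested:
  assumes "P \<in> dyadics" "Q \<in> dyadics" "P \<inter> Q \<noteq> {}"
  shows "P \<subseteq> Q \<or> Q \<subseteq> P"
proof -
  obtain x where x: "x \<in> P" "x \<in> Q" using assms(3) by blast
  obtain j k where "P = dyadic_cube j x" "Q = dyadic_cube k x"
    using assms(1,2) x dyadic_cube_eq unfolding dyadics_def by blast
  then show ?thesis
    using dyadic_cube_antimono[of j k x] dyadic_cube_antimono[of k j x] linear[of j k] by blast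
qed

text \<open>Finiteness gives every cube a maximal one above it, and maximal cubes that meet would be
  nested and hence equal. This turns a measure of a union into a sum without overlap.\<close>

lemma dyadics_maximal:
  assumes "finite F" "F \<subseteq> dyadics"
  obtains F' where "F' \<subseteq> F" "\<Union>F' = \<Union>F" "pairwise disjnt F'"
    "\<And>Q. Q \<in> F \<Longrightarrow> \<exists>P\<in>F'. Q \<subseteq> P"
proof -
  define F' where "F' = {Q\<in>F. \<forall>P\<in>F. Q \<subseteq> P \<longrightarrow> Q = P}"
  have sub: "F' \<subseteq> F" by (auto simp: F'_def)
  have ex: "\<exists>P\<in>F'. Q \<subseteq> P" if "Q \<in> F" for Q
    using finite_has_maximal2[OF assms(1) that] unfolding F'_def by blast
  have "pairwise disjnt F'"
  proof (rule pairwiseI)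
    fix P Q assume PQ: "P \<in> F'" "Q \<in> F'" "P \<noteq> Q"
    then have d: "P \<in> dyadics" "Q \<in> dyadics" using sub assms(2) by auto
    have "\<not> P \<subseteq> Q" "\<not> Q \<subseteq> P" using PQ sub by (auto simp: F'_def)
    then show "disjnt P Q" using dyadics_nested[OF d] by (auto simp: disjnt_def)
  qed
  moreover have "\<Union>F' = \<Union>F" using ex sub by blast
  ultimately show ?thesis using that sub ex by blast
qed

section \<open>Closed axis-parallel cubes and their volume\<close>

lemma cubesI: "0 < r \<Longrightarrow> cbox a (a + vec r) \<in> cubes"
  by (auto simp: cubes_def)

lemma cubes_centeredI: "0 < r \<Longrightarrow> cbox (x - vec r) (x + vec r) \<in> cubes"
proof -
  assume "0 < r"
  moreover have "x + vec r = (x - vec r) + vec (2 * r)"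
    by (simp add: vec_eq_iff)
  ultimately show ?thesis
    using cubesI[of "2 * r" "x - vec r"] by (metis mult_pos_pos zero_less_numeral)
qed

lemma measure_cube:
  assumes "0 \<le> r"
  shows "measure lebesgue (cbox a (a + vec r) :: (real^'n) set) = r ^ CARD('n)"
  using assms by (simp add: content_cbox_if_cart interval_eq_empty_cart not_less) 

lemma measure_centered_cube:
  assumes "0 \<le> r"
  shows "measure lebesgue (cbox (x - vec r) (x + vec r) :: (real^'n) set) = (2 * r) ^ CARD('n)"
proof -
  have "x + vec r = (x - vec r) + vec (2 * r)"
    by (simp add: vec_eq_iff)
  then show ?thesis using measure_cube[of "2 * r" "x - vec r"] assms by (metis mult_nonneg_nonneg zero_le_numeral)
qed

section \<open>Dyadic cubes as half-open boxes\<close>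

definition dyadic_side :: "int \<Rightarrow> real" where "dyadic_side j = 2 powi (- j)"

lemma dyadic_side_pos [simp]: "0 < dyadic_side j"
  by (simp add: dyadic_side_def)

text \<open>Dyadic cubes are half-open so that each generation tiles the space, whereas the weight
  conditions speak of closed cubes. The closure, which adds only a null set, carries those
  conditions over.\<close>

definition dyadic_closed :: "int \<Rightarrow> real^'n \<Rightarrow> (real^'n) set" where
  "dyadic_closed j x = (let a = (\<chi> i. of_int \<lfloor>2 powi j * x$i\<rfloor> * dyadic_side j) in cbox a (a + vec (dyadic_side j)))"

lemma dyadic_closed_in_cubes [simp]: "dyadic_closed j x \<in> cubes"
  by (simp add: dyadic_closed_def Let_def cubesI)

lemma dyadic_cube_alt:
  "dyadic_cube j x = {y. \<forall>i. of_int \<lfloor>2 powi j * x$i\<rfloor> * dyadic_side j \<le> y$i \<and>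
     y$i < of_int \<lfloor>2 powi j * x$i\<rfloor> * dyadic_side j + dyadic_side j}"
proof -
  have "\<lfloor>2 powi j * t\<rfloor> = k \<longleftrightarrow> of_int k * dyadic_side j \<le> t \<and> t < of_int k * dyadic_side j + dyadic_side j"
    for t :: real and k :: int
  proof -
    have "\<lfloor>2 powi j * t\<rfloor> = k \<longleftrightarrow> of_int k \<le> 2 powi j * t \<and> 2 powi j * t < of_int k + 1"
      by (simp add: floor_eq_iff)
    also have "\<dots> \<longleftrightarrow> of_int k * dyadic_side j \<le> t \<and> t < of_int k * dyadic_side j + dyadic_side j"
      by (simp add: dyadic_side_def power_int_minus field_simps)
    finally show ?thesis .
  qed
  then show ?thesis by (simp add: dyadic_cube_def)
qed

lemma dyadic_cube_subset_closed: "dyadic_cube j x \<subseteq> dyadic_closed j x"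
  unfolding dyadic_cube_alt dyadic_closed_def Let_def subset_iff mem_box_cart mem_Collect_eq
  by (simp add: less_imp_le)

lemma sets_dyadic: "dyadic_cube j x \<in> sets borel"
proof -
  have "dyadic_cube j x = (\<Inter>i. {y. \<lfloor>2 powi j * y$i\<rfloor> = \<lfloor>2 powi j * x$i\<rfloor>})"
    by (auto simp: dyadic_cube_def)
  also have "\<dots> \<in> sets borel"
    by measurable
  finally show ?thesis .
qed

lemma sets_dyadics [simp]: "Q \<in> dyadics \<Longrightarrow> Q \<in> sets lebesgue"
  unfolding dyadics_def using sets_completionI_sets[of _ lborel] sets_dyadic by fastforce

lemma bounded_dyadics: "Q \<in> dyadics \<Longrightarrow> bounded Q"
  using dyadic_cube_subset_closed bounded_subset[OF bounded_cbox]
  unfolding dyadics_def dyadic_closed_def Let_def by blast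

lemma bounded_cubes: "Q \<in> cubes \<Longrightarrow> bounded Q"
  by (auto simp: cubes_def)

lemma sets_cubes [simp]: "Q \<in> cubes \<Longrightarrow> Q \<in> sets lebesgue"
  by (auto simp: cubes_def)

text \<open>The half-open cube contains the open box, so only a part of the frontier is
  left.\<close>

lemma null_dyadic_closed_minus: "dyadic_closed j x - dyadic_cube j x \<in> null_sets lebesgue"
proof -
  define a where "a = (\<chi> i. of_int \<lfloor>2 powi j * x$i\<rfloor> * dyadic_side j)"
  have "dyadic_closed j x - dyadic_cube j x \<subseteq> cbox a (a + vec (dyadic_side j)) - box a (a + vec (dyadic_side j))"
    by (auto simp: dyadic_cube_alt dyadic_closed_def Let_def mem_box_cart a_def intro: less_imp_le)
  then show ?thesis
    using negligible_frontier_interval negligible_subset negligible_iff_null_sets by blast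
qed

lemma measure_dyadic: "measure lebesgue (dyadic_cube j x :: (real^'n) set) = dyadic_side j ^ CARD('n)"
proof -
  have "measure lebesgue (dyadic_cube j x) = measure lebesgue (dyadic_closed j x)"
    using measure_Diff_null_set[OF _ null_dyadic_closed_minus[of j x], of "dyadic_closed j x"]
      dyadic_cube_subset_closed[of j x]
    by (simp add: double_diff)
  then show ?thesis
    unfolding dyadic_closed_def Let_def by (metis measure_cube dyadic_side_pos less_imp_le)
qed

lemma measure_dyadics_pos: "Q \<in> dyadics \<Longrightarrow> 0 < measure lebesgue (Q :: (real^'n) set)"
  by (auto simp: dyadics_def measure_dyadic)

lemma countable_dyadics: "countable (dyadics :: (real^'n) set set)"
proof -
  have "(dyadics :: (real^'n) set set) \<subseteq> range (\<lambda>(j, z :: int^'n). {y. \<forall>i. \<lfloor>2 powi j * y$i\<rfloor> = z$i})"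
  proof
    fix Q :: "(real^'n) set" assume "Q \<in> dyadics"
    then obtain j x where "Q = dyadic_cube j x" by (auto simp: dyadics_def)
    then show "Q \<in> range (\<lambda>(j, z :: int^'n). {y. \<forall>i. \<lfloor>2 powi j * y$i\<rfloor> = z$i})"
      by (intro image_eqI[of _ _ "(j, \<chi> i. \<lfloor>2 powi j * x$i\<rfloor>)"]) (auto simp: dyadic_cube_def)
  qed
  then show ?thesis by (rule countable_subset) simp
qed

lemma dyadic_cube_component_dist:
  assumes "y \<in> dyadic_cube j x"
  shows "\<bar>y$i - x$i\<bar> < dyadic_side j"
proof -
  have "x \<in> dyadic_cube j x" by simp
  then show ?thesis using assms unfolding dyadic_cube_alt mem_Collect_eq
    by (meson abs_diff_less_iff add_less_cancel_right dual_order.strict_trans1 dual_order.strict_trans2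
      add_mono_thms_linordered_field(3) less_diff_eq diff_less_eq) 
qed

text \<open>The Euclidean norm is at most the sum of the \<open>CARD('a)\<close> coordinate
  differences, each below the side. The condition \<open>k \<ge> j\<close> keeps the cube inside a
  given cube of generation \<open>j\<close> around the same point.\<close>

lemma dyadic_cube_small_in_open:
  assumes "open U" "x \<in> U"
  obtains k where "k \<ge> j" "dyadic_cube k x \<subseteq> U"
proof -
  obtain e where e: "e > 0" "ball x e \<subseteq> U"
    using assms openE by blast
  obtain n where n: "(1/2::real) ^ n < e / (CARD('a) * 2 powi (-j))"
    using real_arch_pow_inv[of "e / (CARD('a) * 2 powi (-j))" "1/2"] e by auto
  have "dyadic_cube (j + int n) x \<subseteq> U"
  proof
    fix y assume y: "y \<in> dyadic_cube (j + int n) x"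
    have "norm (y - x) \<le> (\<Sum>i\<in>UNIV. \<bar>(y - x)$i\<bar>)"
      by (rule norm_le_l1_cart)
    also have "\<dots> \<le> (\<Sum>i\<in>(UNIV::'a set). dyadic_side (j + int n))"
      using dyadic_cube_component_dist[OF y] by (intro sum_mono) (auto intro: less_imp_le)
    also have "\<dots> = CARD('a) * 2 powi (-j) * (1/2)^n"
      by (simp add: dyadic_side_def power_int_add power_int_minus power_one_over field_simps power_int_diff)
    also have "\<dots> < e"
      using n by (simp add: field_simps)
    finally show "y \<in> U"
      using e by (auto simp: dist_norm norm_minus_commute)
  qed
  then show ?thesis using that[of "j + int n"] by simp
qed

section \<open>Measures finite on bounded sets\<close>

text \<open>Descend from \<open>P\<close> towards \<open>Q\<close> and stop at the first cube where
  the density of \<open>U\<close> exceeds \<alpha>; this happens at \<open>Q\<close> at the latest,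
  where the density is 1, and not at \<open>P\<close>. The parent of the stopping cube still has
  density at most \<alpha> and is 2^n times as large, so the density in the stopping cube is at most
  2^n \<alpha> = 1/2. This fixes the value of \<alpha>.\<close>

lemma dyadic_stopping:
  fixes P Q U :: "(real^'n) set"
  defines "\<alpha> \<equiv> 1 / 2 ^ (CARD('n) + 1) :: real"
  assumes PQ: "P \<in> dyadics" "Q \<in> dyadics" "Q \<subseteq> P" "Q \<subseteq> U" and U: "U \<in> sets lebesgue"
    and small: "measure lebesgue (U \<inter> P) \<le> \<alpha> * measure lebesgue P"
  obtains R where "R \<in> dyadics" "Q \<subseteq> R" "R \<subseteq> P"
    "\<alpha> * measure lebesgue R < measure lebesgue (U \<inter> R)"
    "measure lebesgue (U \<inter> R) \<le> measure lebesgue R / 2"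
proof -
  have \<alpha>: "0 < \<alpha>" "\<alpha> < 1" unfolding \<alpha>_def
    using one_less_power[of "2::real" "CARD('n) + 1"] by simp_all
  obtain k x where Q: "Q = dyadic_cube k x" using PQ by (auto simp: dyadics_def)
  obtain j x0 where P: "P = dyadic_cube j x0" using PQ by (auto simp: dyadics_def)
  have "x \<in> dyadic_cube j x0" using PQ Q P by auto
  with P have P: "P = dyadic_cube j x" by (simp add: dyadic_cube_eq)
  \<comment> \<open>The inclusion of the sets does not hand over their generations. If
    \<open>Q\<close> had the coarser one, it would equal \<open>P\<close>, and \<open>P\<close>
    would have density 1.\<close>
  have "j \<le> k"
  proof (rule ccontr)
    assume "\<not> j \<le> k"
    then have "Q = P" using dyadic_cube_antimono[of k j x] PQ P Q by auto
    then have "U \<inter> P = P" using PQ by auto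
    with small have "measure lebesgue P \<le> \<alpha> * measure lebesgue P" by simp
    with \<alpha> measure_dyadics_pos[OF PQ(1)] show False by (simp add: field_simps)
  qed
  then obtain d where d: "k = j + int d" by (metis zle_iff_zadd)
  define R where "R i = dyadic_cube (j + int i) x" for i
  define L where "L i \<longleftrightarrow> \<alpha> * measure lebesgue (R i) < measure lebesgue (U \<inter> R i)" for i
  have "U \<inter> R d = R d" using PQ Q by (auto simp: R_def d)
  then have Ld: "L d"
    using \<alpha> measure_dyadics_pos[of "R d"] by (simp add: L_def R_def)
  have L0: "\<not> L 0" using small by (simp add: L_def R_def P)
  define i where "i = (LEAST i. L i)"
  have Li: "L i" and id: "i \<le> d"
    using Ld by (auto simp: i_def intro: LeastI Least_le)
  with L0 obtain i' where i': "i = Suc i'" by (cases i) auto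
  have "\<not> L i'" using not_less_Least[of i' L] i' by (simp add: i_def)
  then have "measure lebesgue (U \<inter> R i') \<le> \<alpha> * measure lebesgue (R i')" by (simp add: L_def)
  also have "measure lebesgue (R i') = 2 ^ CARD('n) * measure lebesgue (R i)"
  proof -
    have "dyadic_side (j + int i') = 2 * dyadic_side (j + int i)"
      using power_int_add_1'[of "2::real" "- (j + int i)"] by (simp add: dyadic_side_def i' algebra_simps)
    then show ?thesis by (simp add: R_def measure_dyadic power_mult_distrib)
  qed
  also have "\<alpha> * (2 ^ CARD('n) * measure lebesgue (R i)) = measure lebesgue (R i) / 2"
    by (simp add: \<alpha>_def)
  finally have *: "measure lebesgue (U \<inter> R i') \<le> measure lebesgue (R i) / 2" .
  have "U \<inter> R i' \<in> lmeasurable"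
    unfolding R_def
    by (intro bounded_set_imp_lmeasurable bounded_Int disjI2 bounded_dyadics dyadic_cube_in_dyadics
        sets.Int U sets_dyadics)
  moreover have "U \<inter> R i \<in> sets lebesgue"
    unfolding R_def by (intro sets.Int U sets_dyadics dyadic_cube_in_dyadics)
  moreover have "R i \<subseteq> R i'" unfolding R_def i' by (rule dyadic_cube_antimono) simp
  ultimately have le: "measure lebesgue (U \<inter> R i) \<le> measure lebesgue (U \<inter> R i')"
    by (intro measure_mono_fmeasurable Int_mono order_refl)
  show ?thesis
  proof
    show "R i \<in> dyadics" by (simp add: R_def)
    show "Q \<subseteq> R i" unfolding Q R_def d using id by (intro dyadic_cube_antimono) simp
    show "R i \<subseteq> P" unfolding P R_def by (intro dyadic_cube_antimono) simp
    show "\<alpha> * measure lebesgue (R i) < measure lebesgue (U \<inter> R i)" using Li by (simp add: L_def)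
    show "measure lebesgue (U \<inter> R i) \<le> measure lebesgue (R i) / 2" using le * by linarith
  qed
qed

text \<open>Collects what Lebesgue measure, N and M share, so that the facts on finite dyadic
  families are available for all three. The condition \<open>null\<close> permits the exchange of
  half-open and closed cubes.\<close>

locale bounded_finite_measure =
  fixes X :: "(real^'n) measure"
  assumes sets_eq: "sets X = sets lebesgue"
    and finite_bounded: "bounded S \<Longrightarrow> S \<in> sets lebesgue \<Longrightarrow> emeasure X S < \<infinity>"
    and null: "null_sets lebesgue \<subseteq> null_sets X"
begin

lemma fmeasurable_bounded: "S \<in> sets lebesgue \<Longrightarrow> bounded S \<Longrightarrow> S \<in> fmeasurable X"
  using finite_bounded sets_eq by (intro fmeasurableI) auto

lemma measure_mono_bounded: "S \<subseteq> T \<Longrightarrow> S \<in> sets lebesgue \<Longrightarrow> T \<in> sets lebesgue \<Longrightarrow> bounded T \<Longrightarrow>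
    measure X S \<le> measure X T"
  by (intro measure_mono_fmeasurable fmeasurable_bounded) (auto simp: sets_eq)

lemma measure_diff_bounded:
  "S \<subseteq> T \<Longrightarrow> S \<in> sets lebesgue \<Longrightarrow> T \<in> sets lebesgue \<Longrightarrow> bounded T \<Longrightarrow>
    measure X (T - S) = measure X T - measure X S"
  by (intro measurable_measure_Diff fmeasurable_bounded) (auto simp: sets_eq)

lemma dyadics_closed:
  assumes "Q \<in> dyadics"
  obtains C where "C \<in> cubes" "Q \<subseteq> C" "C - Q \<in> null_sets lebesgue"
proof -
  obtain j x where "Q = dyadic_cube j x" using assms by (auto simp: dyadics_def)
  then show ?thesis
    using that[of "dyadic_closed j x"] dyadic_cube_subset_closed null_dyadic_closed_minus dyadic_closed_in_cubes by metis
qed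

lemma measure_eq_null:
  assumes "Q \<in> sets lebesgue" "C \<in> sets lebesgue" "Q \<subseteq> C" "C - Q \<in> null_sets lebesgue"
  shows "measure X C = measure X Q"
proof -
  have "measure X (C - (C - Q)) = measure X C"
    using assms null by (intro measure_Diff_null_set) (auto simp: sets_eq)
  then show ?thesis using assms(3) by (simp add: double_diff)
qed

lemma measure_disjoint_Union:
  assumes "finite F" "F \<subseteq> dyadics" "pairwise disjnt F"
  shows "measure X (\<Union>F) = (\<Sum>Q\<in>F. measure X Q)"
  by (intro measure_Union' fmeasurable_bounded assms) (meson assms(2) bounded_dyadics sets_dyadics subset_iff)+

lemma measure_Int_disjoint_Union:
  assumes "finite F" "F \<subseteq> dyadics" "pairwise disjnt F" "U \<in> sets lebesgue"
  shows "measure X (U \<inter> \<Union>F) = (\<Sum>Q\<in>F. measure X (U \<inter> Q))"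
proof -
  have "measure X (\<Union>Q\<in>F. U \<inter> Q) = (\<Sum>Q\<in>F. measure X (U \<inter> Q))"
  proof (intro measure_UNION' fmeasurable_bounded)
    show "bounded (U \<inter> Q)" "U \<inter> Q \<in> sets lebesgue" if "Q \<in> F" for Q
      using that assms(2,4) by (meson bounded_Int bounded_dyadics subset_iff sets.Int sets_dyadics)+
    show "pairwise (\<lambda>i j. disjnt (U \<inter> i) (U \<inter> j)) F"
      using assms(3) by (auto simp: pairwise_def disjnt_def)
  qed (rule assms)
  then show ?thesis unfolding Int_Union .
qed

end

interpretation lebesgue: bounded_finite_measure "lebesgue :: (real^'n) measure"
proof
  fix S :: "(real^'n) set" assume "bounded S" "S \<in> sets lebesgue"
  then show "emeasure lebesgue S < \<infinity>"
    using bounded_set_imp_lmeasurable[of S] by (simp only: fmeasurable_def mem_Collect_eq)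
qed (rule refl order_refl)+

section \<open>Power decay for A_1 measures\<close>

text \<open>\<open>A1\<close> and \<open>Ap\<close> are the measure forms of N in A_1 and M in A_p; \<open>V\<close> plays the density of \<open>M\<close> with respect to \<open>N\<close>.\<close>

locale muckenhoupt_pair = N: bounded_finite_measure N + M: bounded_finite_measure M
  for N M :: "(real^'n) measure" +
  fixes V :: "real^'n \<Rightarrow> real" and A B p :: real
  assumes p_pos: "0 < p"
    and N_pos: "Q \<in> cubes \<Longrightarrow> 0 < measure N Q"
    and M_pos: "Q \<in> cubes \<Longrightarrow> 0 < measure M Q"
    and A1: "Q \<in> cubes \<Longrightarrow> E \<in> sets lebesgue \<Longrightarrow> E \<subseteq> Q \<Longrightarrow>
      measure lebesgue E * measure N Q \<le> A * measure N E * measure lebesgue Q"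
    and Ap: "Q \<in> cubes \<Longrightarrow> E \<in> sets lebesgue \<Longrightarrow> E \<subseteq> Q \<Longrightarrow>
      (measure lebesgue E / measure lebesgue Q) powr p * measure M Q \<le> B * measure M E"
    and V_nonneg: "0 \<le> V x"
    and V_measurable: "V \<in> borel_measurable lebesgue"
    and V_bound: "E \<in> sets lebesgue \<Longrightarrow> bounded E \<Longrightarrow> (\<And>x. x \<in> E \<Longrightarrow> V x < c) \<Longrightarrow> 0 < c \<Longrightarrow>
      measure M E \<le> c * measure N E"
begin

lemma dyadic_in_cube:
  assumes "Q \<in> dyadics"
  obtains C where "C \<in> cubes" "Q \<subseteq> C" "measure lebesgue C = measure lebesgue Q"
    "measure N C = measure N Q" "measure M C = measure M Q"
proof -
  obtain C where C: "C \<in> cubes" "Q \<subseteq> C" "C - Q \<in> null_sets lebesgue"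
    using N.dyadics_closed[OF assms] by blast
  note s = sets_dyadics[OF assms] sets_cubes[OF C(1)] C(2,3)
  show ?thesis
    using that[OF C(1,2)] lebesgue.measure_eq_null[OF s] N.measure_eq_null[OF s]
      M.measure_eq_null[OF s] by blast
qed

lemma N_pos_dyadic:
  assumes "Q \<in> dyadics"
  shows "0 < measure N Q"
  by (rule dyadic_in_cube[OF assms]) (use N_pos in force)

lemma M_pos_dyadic:
  assumes "Q \<in> dyadics"
  shows "0 < measure M Q"
  by (rule dyadic_in_cube[OF assms]) (use M_pos in force)

lemma A1_dyadic:
  assumes "Q \<in> dyadics" "E \<in> sets lebesgue" "E \<subseteq> Q"
  shows "measure lebesgue E * measure N Q \<le> A * measure N E * measure lebesgue Q"
proof -
  obtain C where C: "C \<in> cubes" "Q \<subseteq> C" "measure lebesgue C = measure lebesgue Q"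
    "measure N C = measure N Q" "measure M C = measure M Q"
    using dyadic_in_cube[OF assms(1)] by blast
  show ?thesis
    using A1[OF C(1) assms(2)] C(2) assms(3) unfolding C(3-5) by blast
qed

lemma Ap_dyadic:
  assumes "Q \<in> dyadics" "E \<in> sets lebesgue" "E \<subseteq> Q"
  shows "(measure lebesgue E / measure lebesgue Q) powr p * measure M Q \<le> B * measure M E"
proof -
  obtain C where C: "C \<in> cubes" "Q \<subseteq> C" "measure lebesgue C = measure lebesgue Q"
    "measure N C = measure N Q" "measure M C = measure M Q"
    using dyadic_in_cube[OF assms(1)] by blast
  show ?thesis
    using Ap[OF C(1) assms(2)] C(2) assms(3) unfolding C(3-5) by blast
qed

lemma A_ge: "1 \<le> A"
  using A1_dyadic[of "dyadic_cube 0 0" "dyadic_cube 0 0"] N_pos_dyadic[of "dyadic_cube 0 0"] measure_dyadics_pos[of "dyadic_cube 0 (0::real^'n)"]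
  by simp

lemma B_ge: "1 \<le> B"
  using Ap_dyadic[of "dyadic_cube 0 0" "dyadic_cube 0 0"] M_pos_dyadic[of "dyadic_cube 0 0"] measure_dyadics_pos[of "dyadic_cube 0 (0::real^'n)"]
  by simp

definition \<beta> :: real where "\<beta> = 1 - 1 / (2 * A)"

lemma \<beta>: "0 < \<beta>" "\<beta> < 1"
  using A_ge by (auto simp: \<beta>_def field_simps)

text \<open>\<open>A1\<close> bounds N from below on large sets, so it is applied to
  \<open>Q - E\<close>: this has at least half of the volume and therefore at least the fraction
  1/(2A) of N(Q). The value of \<beta> is what remains for \<open>E\<close>.\<close>

lemma N_le_if_half:
  assumes Q: "Q \<in> dyadics" and E: "E \<in> sets lebesgue" "E \<subseteq> Q"
    and half: "measure lebesgue E \<le> measure lebesgue Q / 2"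
  shows "measure N E \<le> \<beta> * measure N Q"
proof -
  note s = E(2,1) sets_dyadics[OF Q] bounded_dyadics[OF Q]
  have "measure lebesgue (Q - E) \<ge> measure lebesgue Q / 2"
    using lebesgue.measure_diff_bounded[OF s] half by linarith
  then have "measure lebesgue Q / 2 * measure N Q \<le> measure lebesgue (Q - E) * measure N Q"
    by (intro mult_right_mono) auto
  also have "\<dots> \<le> A * measure N (Q - E) * measure lebesgue Q"
    using Q E sets.Diff[OF sets_dyadics[OF Q] E(1)] by (intro A1_dyadic) auto
  also have "measure N (Q - E) = measure N Q - measure N E"
    by (rule N.measure_diff_bounded[OF s])
  finally have "(measure N Q / 2) * measure lebesgue Q \<le> (A * (measure N Q - measure N E)) * measure lebesgue Q"
    by (simp add: algebra_simps)
  then have "measure N Q / 2 \<le> A * (measure N Q - measure N E)"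
    using measure_dyadics_pos[OF Q] by (simp only: mult_le_cancel_right_pos)
  then show ?thesis using A_ge by (simp add: \<beta>_def field_simps)
qed

definition \<alpha> :: real where "\<alpha> = 1 / 2 ^ (CARD('n) + 1)"

lemma \<alpha>: "0 < \<alpha>" "\<alpha> < 1"
  unfolding \<alpha>_def using one_less_power[of "2::real" "CARD('n) + 1"] by simp_all

lemma finite_Union_sets:
  "finite F \<Longrightarrow> F \<subseteq> dyadics \<Longrightarrow> \<Union>F \<in> sets lebesgue"
  using sets_dyadics by (intro sets.finite_Union) blast+

text \<open>
  The stopping cubes at density \<open>\<alpha>\<close> cover the set, have \<open>1/\<alpha>\<close> times its Lebesgue measure at most,
  and in each of them the set fills at most half; so each step back costs a factor \<open>\<beta>\<close>.
\<close>

lemma N_iterate: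
  assumes P: "P \<in> dyadics" and F: "finite F" "F \<subseteq> dyadics" "\<And>Q. Q \<in> F \<Longrightarrow> Q \<subseteq> P"
    and small: "measure lebesgue (\<Union>F) \<le> \<alpha> ^ j * measure lebesgue P"
  shows "measure N (\<Union>F) \<le> \<beta> ^ j * measure N P"
  using F small
proof (induction j arbitrary: F)
  case 0
  then show ?case
    using P by (simp add: N.measure_mono_bounded finite_Union_sets bounded_dyadics Union_least)
next
  case (Suc j)
  define U where "U = \<Union>F"
  have U: "U \<in> sets lebesgue" "U \<subseteq> P" using Suc.prems by (auto simp: U_def finite_Union_sets)
  have "\<exists>R\<in>dyadics. Q \<subseteq> R \<and> R \<subseteq> P \<and> \<alpha> * measure lebesgue R < measure lebesgue (U \<inter> R) \<and>
      measure lebesgue (U \<inter> R) \<le> measure lebesgue R / 2" if "Q \<in> F" for Q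
  proof -
    have "\<alpha> ^ Suc j * measure lebesgue P \<le> \<alpha> * measure lebesgue P"
      using \<alpha> by (intro mult_right_mono) (auto simp: mult_left_le power_le_one)
    with Suc.prems(4) U have "measure lebesgue (U \<inter> P) \<le> \<alpha> * measure lebesgue P"
      by (simp add: U_def Int_absorb2)
    moreover have "Q \<in> dyadics" "Q \<subseteq> P" "Q \<subseteq> U" using that Suc.prems by (auto simp: U_def)
    ultimately show ?thesis using dyadic_stopping[OF P _ _ _ U(1), of Q] unfolding \<alpha>_def by metis
  qed
  then obtain h where h: "\<And>Q. Q \<in> F \<Longrightarrow> h Q \<in> dyadics \<and> Q \<subseteq> h Q \<and> h Q \<subseteq> P \<and>
      \<alpha> * measure lebesgue (h Q) < measure lebesgue (U \<inter> h Q) \<and>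
      measure lebesgue (U \<inter> h Q) \<le> measure lebesgue (h Q) / 2"
    by metis
  obtain G where G: "G \<subseteq> h ` F" "\<Union>G = \<Union>(h ` F)" "pairwise disjnt G"
    using dyadics_maximal[of "h ` F"] Suc.prems h by (metis finite_imageI image_subsetI)
  have Gd: "G \<subseteq> dyadics" "finite G" "\<And>R. R \<in> G \<Longrightarrow> R \<subseteq> P"
    using G h Suc.prems by (auto intro: finite_subset)
  have UG: "U \<subseteq> \<Union>G" using h by (auto simp: G U_def)
  have "\<alpha> * measure lebesgue (\<Union>G) = (\<Sum>R\<in>G. \<alpha> * measure lebesgue R)"
    using lebesgue.measure_disjoint_Union[OF Gd(2,1) G(3)] by (simp add: sum_distrib_left)
  also have "\<dots> \<le> (\<Sum>R\<in>G. measure lebesgue (U \<inter> R))"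
    using G h by (intro sum_mono) (auto simp: less_imp_le)
  also have "\<dots> = measure lebesgue U"
    using lebesgue.measure_Int_disjoint_Union[OF Gd(2,1) G(3) U(1)] UG by (simp add: Int_absorb2)
  also have "\<dots> \<le> \<alpha> ^ Suc j * measure lebesgue P" using Suc.prems by (simp add: U_def)
  finally have "measure lebesgue (\<Union>G) \<le> \<alpha> ^ j * measure lebesgue P"
    using \<alpha> by (simp add: mult.assoc)
  with Suc.IH Gd have NG: "measure N (\<Union>G) \<le> \<beta> ^ j * measure N P" by blast
  have "measure N U = (\<Sum>R\<in>G. measure N (U \<inter> R))"
    using N.measure_Int_disjoint_Union[OF Gd(2,1) G(3) U(1)] UG by (simp add: Int_absorb2)
  also have "\<dots> \<le> (\<Sum>R\<in>G. \<beta> * measure N R)"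
  proof (intro sum_mono N_le_if_half)
    fix R assume "R \<in> G"
    then obtain Q where "Q \<in> F" "R = h Q" using G by auto
    then show "R \<in> dyadics" "U \<inter> R \<in> sets lebesgue" "measure lebesgue (U \<inter> R) \<le> measure lebesgue R / 2"
      using h[of Q] sets.Int[OF U(1) sets_dyadics[of R]] by auto
  qed auto
  also have "\<dots> = \<beta> * measure N (\<Union>G)"
    using N.measure_disjoint_Union[OF Gd(2,1) G(3)] by (simp add: sum_distrib_left)
  also have "\<dots> \<le> \<beta> * (\<beta> ^ j * measure N P)" using NG \<beta> by simp
  finally show ?case by (simp add: U_def mult.assoc)
qed

text \<open>Each point of \<open>T \<inter> P\<close> lies in a dyadic cube contained in that set,
  and there are only countably many dyadic cubes. Finite partial unions fall under
  \<open>N_iterate\<close>, and continuity from below gives the limit.\<close>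

lemma N_iterate_open:
  assumes P: "P \<in> dyadics" and T: "open T"
    and small: "measure lebesgue (T \<inter> P) \<le> \<alpha> ^ j * measure lebesgue P"
  shows "measure N (T \<inter> P) \<le> \<beta> ^ j * measure N P"
proof (cases "T \<inter> P = {}")
  case True
  then show ?thesis using \<beta> by simp
next
  case False
  define F where "F = {D\<in>dyadics. D \<subseteq> T \<inter> P}"
  have TP: "T \<inter> P \<in> sets lebesgue" "bounded (T \<inter> P)"
    using P T by (simp_all add: bounded_Int bounded_dyadics sets.Int)
  have in_F: "\<exists>D\<in>F. x \<in> D" if x: "x \<in> T \<inter> P" for x
  proof -
    obtain j x0 where "P = dyadic_cube j x0" using P by (auto simp: dyadics_def)
    with that have j: "P = dyadic_cube j x" by (metis Int_iff dyadic_cube_eq)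
    obtain k where k: "k \<ge> j" "dyadic_cube k x \<subseteq> T"
      using dyadic_cube_small_in_open[OF T, of x j] x by blast
    then have "dyadic_cube k x \<in> F" using dyadic_cube_antimono[OF k(1), of x] j by (auto simp: F_def)
    then show ?thesis by (metis mem_dyadic_cube_self)
  qed
  then have FU: "\<Union>F = T \<inter> P" by (auto simp: F_def)
  have F: "countable F" "F \<noteq> {}"
    using countable_subset[OF _ countable_dyadics, of F] FU False by (auto simp: F_def)
  define D where "D i = \<Union>(from_nat_into F ` {..i})" for i :: nat
  have fin: "from_nat_into F ` {..i} \<subseteq> F" for i
    using from_nat_into[OF F(2)] by auto
  have Fsub: "F \<subseteq> dyadics" by (auto simp: F_def)
  have Ds: "D i \<in> sets lebesgue" for i
    unfolding D_def using fin[of i] Fsub by (intro finite_Union_sets) auto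
  have Dsub: "D i \<subseteq> T \<inter> P" for i
    using fin[of i] FU by (auto simp: D_def)
  have DU: "(\<Union>i. D i) = T \<inter> P"
  proof -
    have "(\<Union>i. D i) = \<Union>(range (from_nat_into F))" by (auto simp: D_def)
    then show ?thesis using range_from_nat_into[OF F(2,1)] FU by simp
  qed
  have "(\<lambda>i. measure N (D i)) \<longlonglongrightarrow> measure N (\<Union>i. D i)"
  proof (rule Lim_measure_incseq)
    show "range D \<subseteq> sets N" using Ds N.sets_eq by auto
    show "incseq D"
      unfolding incseq_def D_def by (intro allI impI Union_mono image_mono) auto
    show "emeasure N (\<Union>i. D i) \<noteq> \<infinity>" using N.finite_bounded[OF TP(2,1)] by (simp add: DU)
  qed
  moreover have "measure N (D i) \<le> \<beta> ^ j * measure N P" for i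
    unfolding D_def
  proof (rule N_iterate[OF P])
    show "measure lebesgue (\<Union>(from_nat_into F ` {..i})) \<le> \<alpha> ^ j * measure lebesgue P"
      using lebesgue.measure_mono_bounded[OF Dsub Ds TP] small unfolding D_def by (rule order_trans)
    show "from_nat_into F ` {..i} \<subseteq> dyadics" using fin[of i] Fsub by blast
    show "Q \<subseteq> P" if "Q \<in> from_nat_into F ` {..i}" for Q
      using that fin[of i] unfolding F_def by blast
  qed simp
  ultimately show ?thesis unfolding DU by (intro LIMSEQ_le_const2) auto
qed

text \<open>The geometric decay \<beta>^j at density \<alpha>^j is rewritten as a power of the
  density. Measurable sets are reached through open supersets of at most twice the volume.\<close>

lemma N_decay:
  obtains C d where "0 < C" "0 < d" "\<And>Q E. Q \<in> dyadics \<Longrightarrow> E \<in> sets lebesgue \<Longrightarrow> E \<subseteq> Q \<Longrightarrow>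
    measure N E \<le> C * (measure lebesgue (E :: (real^'n) set) / measure lebesgue Q) powr d * measure N Q"
proof -
  \<comment> \<open>Chosen so that \<alpha>^d = \<beta>. In the constant below,
    \<open>2 powr d\<close> pays for the open superset and the division by \<beta> for rounding the
    density to a power of \<alpha>.\<close>
  define d where "d = ln \<beta> / ln \<alpha>"
  have d: "0 < d" using \<alpha> \<beta> by (simp add: d_def divide_neg_neg)
  have \<alpha>d: "\<alpha> powr d = \<beta>" using \<alpha> \<beta> by (simp add: d_def powr_def)
  define C where "C = 2 powr d / \<beta>"
  have C: "0 < C" using \<beta> by (simp add: C_def)
  show ?thesis
  proof (rule that[OF C d])
    fix Q E :: "(real^'n) set" assume Q: "Q \<in> dyadics" and E: "E \<in> sets lebesgue" "E \<subseteq> Q"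
    define s where "s = measure lebesgue E / measure lebesgue Q"
    have Qpos: "0 < measure lebesgue Q" by (rule measure_dyadics_pos[OF Q])
    have bE: "bounded E" using bounded_subset[OF bounded_dyadics[OF Q] E(2)] .
    show "measure N E \<le> C * (measure lebesgue E / measure lebesgue Q) powr d * measure N Q"
    proof (cases "measure lebesgue E = 0")
      case True
      then have "E \<in> null_sets lebesgue"
        using emeasure_eq_measure2[OF lebesgue.fmeasurable_bounded[OF E(1) bE]] E by (simp add: null_sets_def)
      then have "E \<in> null_sets N" using N.null by auto
      then have "measure N E = 0" by (simp add: null_sets_def measure_def)
      then show ?thesis using C by simp
    next
      case False
      then have Epos: "0 < measure lebesgue E" by (simp add: less_le)
      then have s: "0 < s" using Qpos by (simp add: s_def)
      \<comment> \<open>The permitted excess is the volume of \<open>E\<close> itself, which must be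
        positive for this; null sets are therefore treated apart.\<close>
      obtain T where T: "open T" "E \<subseteq> T" "T - E \<in> lmeasurable"
        "emeasure lebesgue (T - E) < ennreal (measure lebesgue E)"
        using sets_lebesgue_outer_open[OF E(1) Epos] by blast
      have "measure lebesgue (T - E) \<le> measure lebesgue E"
        using T(3,4) by (simp add: emeasure_eq_measure2 ennreal_less_iff)
      moreover have "measure lebesgue (T \<inter> Q) \<le> measure lebesgue (E \<union> (T - E))"
      proof (rule measure_mono_fmeasurable)
        show "E \<union> (T - E) \<in> lmeasurable"
          using lebesgue.fmeasurable_bounded[OF E(1) bE] T(3) by (rule fmeasurable.Un)
      qed (use T Q E in \<open>auto intro!: sets.Int\<close>)
      moreover have "measure lebesgue (E \<union> (T - E)) \<le> measure lebesgue E + measure lebesgue (T - E)"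
        using T(3) E by (intro measure_Un_le) auto
      ultimately have TQ: "measure lebesgue (T \<inter> Q) \<le> 2 * s * measure lebesgue Q"
        using Qpos by (simp add: s_def)
      have "\<exists>j. \<alpha> ^ j < 2 * s" using real_arch_pow_inv[of "2 * s" \<alpha>] s \<alpha> by auto
      then have L: "\<alpha> ^ (LEAST j. \<alpha> ^ j < 2 * s) < 2 * s" by (rule LeastI_ex)
      \<comment> \<open>Normally \<alpha>^(j+1) < 2s \<le> \<alpha>^j. For 2s > 1 the upper bound
        fails and j = 0 is taken, where the claim is just N(E) \<le> N(Q).\<close>
      obtain j where j: "\<alpha> ^ Suc j < 2 * s" "j = 0 \<or> 2 * s \<le> \<alpha> ^ j"
      proof (cases "LEAST j. \<alpha> ^ j < 2 * s")
        case 0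
        then have "\<alpha> ^ Suc 0 < 2 * s" using L \<alpha> by simp
        then show ?thesis using that by blast
      next
        case (Suc j)
        then have "\<not> \<alpha> ^ j < 2 * s" using not_less_Least[of j "\<lambda>j. \<alpha> ^ j < 2 * s"] by simp
        then show ?thesis using that[of j] L Suc by simp
      qed
      have "measure N E \<le> \<beta> ^ j * measure N Q"
      proof (cases "2 * s \<le> \<alpha> ^ j")
        case True
        have "measure N E \<le> measure N (T \<inter> Q)"
          using T Q E bounded_dyadics[OF Q]
          by (intro N.measure_mono_bounded) (auto intro!: sets.Int bounded_Int)
        also have "\<dots> \<le> \<beta> ^ j * measure N Q"
        proof (rule N_iterate_open[OF Q T(1)])
          show "measure lebesgue (T \<inter> Q) \<le> \<alpha> ^ j * measure lebesgue Q"
            using TQ mult_right_mono[OF True, of "measure lebesgue Q"] Qpos by linarith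
        qed
        finally show ?thesis .
      next
        case False
        then have "j = 0" using j by simp
        then show ?thesis
          using N.measure_mono_bounded[OF E(2,1) sets_dyadics[OF Q] bounded_dyadics[OF Q]] by simp
      qed
      also have "\<beta> ^ j = \<beta> ^ Suc j / \<beta>" using \<beta> by simp
      also have "\<beta> ^ Suc j = (\<alpha> ^ Suc j) powr d"
        by (metis \<alpha>d \<alpha>(1) powr_power powr_powr powr_realpow mult.commute less_imp_neq)
      also have "(\<alpha> ^ Suc j) powr d / \<beta> * measure N Q \<le> (2 * s) powr d / \<beta> * measure N Q"
        using j(1) \<alpha> \<beta> d N_pos_dyadic[OF Q]
        by (intro mult_right_mono divide_right_mono powr_mono2) (auto simp: less_imp_le)
      also have "\<dots> = C * s powr d * measure N Q"
        using s by (simp add: C_def powr_mult)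
      finally show ?thesis by (simp add: s_def)
    qed
  qed
qed

end

section \<open>Principal cubes\<close>

context muckenhoupt_pair
begin

text \<open>With V as density, M(Q)/N(Q) is the N-average of V over Q, so these are the points where
  V stays below \<open>c\<close> times its average. Clearing the denominator keeps the condition
  linear in V.\<close>

definition sublevel :: "real \<Rightarrow> (real^'n) set \<Rightarrow> (real^'n) set" where
  "sublevel c Q = {x\<in>Q. V x * measure N Q < c * measure M Q}"

lemma sublevel_subset: "sublevel c Q \<subseteq> Q"
  by (auto simp: sublevel_def)

lemma sets_V_less:
  assumes "Q \<in> sets lebesgue"
  shows "{x\<in>Q. V x * k < l} \<in> sets lebesgue"
proof -
  have "{x \<in> space lebesgue. V x * k < l} \<in> sets lebesgue"
    using V_measurable by measurable
  then show ?thesis using assms sets.Int[of "{x. V x * k < l}" lebesgue Q]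
    by (simp add: Int_def conj_commute)
qed

lemma sets_sublevel: "Q \<in> sets lebesgue \<Longrightarrow> sublevel c Q \<in> sets lebesgue"
  unfolding sublevel_def by (rule sets_V_less)

text \<open>Write E for the sublevel set. V < c M(Q)/N(Q) on E together with N(E) \<le> N(Q) gives
  M(E) \<le> c M(Q), hence (|E|/|Q|)^p \<le> B c by \<open>Ap_dyadic\<close>. By power decay N(E) is
  then at most a multiple of c^e N(Q), and inserting this into the same bound on V yields the
  exponent 1 + e.\<close>

lemma sublevel_estimate:
  obtains C e where "0 < C" "0 < e" "\<And>Q c. Q \<in> dyadics \<Longrightarrow> 0 < c \<Longrightarrow>
    measure M (sublevel c Q) \<le> C * c powr (1 + e) * measure M Q"
proof -
  obtain C0 d where C0: "0 < C0" "0 < d" "\<And>Q E. Q \<in> dyadics \<Longrightarrow> E \<in> sets lebesgue \<Longrightarrow> E \<subseteq> Q \<Longrightarrow>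
      measure N E \<le> C0 * (measure lebesgue E / measure lebesgue Q) powr d * measure N Q"
    using N_decay by metis
  \<comment> \<open>The density of the set is at most (B c)^(1/p), and the decay of N raises it to
    the power d.\<close>
  define e where "e = d / p"
  define C where "C = C0 * B powr e"
  show ?thesis
  proof (rule that[of C e])
    show "0 < C" "0 < e" using C0 B_ge p_pos by (auto simp: C_def e_def)
    fix Q :: "(real^'n) set" and c :: real assume Q: "Q \<in> dyadics" and c: "0 < c"
    define E where "E = sublevel c Q"
    have E: "E \<in> sets lebesgue" "E \<subseteq> Q" "bounded E"
      using sets_sublevel[OF sets_dyadics[OF Q]] bounded_subset[OF bounded_dyadics[OF Q]]
      by (auto simp: E_def sublevel_subset)
    have NQ: "0 < measure N Q" and MQ: "0 < measure M Q" using N_pos_dyadic M_pos_dyadic Q by auto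
    define t where "t = measure lebesgue E / measure lebesgue Q"
    have t: "0 \<le> t" by (simp add: t_def)
    have ME: "measure M E \<le> c * measure M Q / measure N Q * measure N E"
    proof (rule V_bound[OF E(1,3)])
      show "V x < c * measure M Q / measure N Q" if "x \<in> E" for x
        using that NQ by (simp add: E_def sublevel_def field_simps)
    qed (use c NQ MQ in simp)
    also have "\<dots> \<le> c * measure M Q / measure N Q * measure N Q"
      using N.measure_mono_bounded[OF E(2,1) sets_dyadics[OF Q] bounded_dyadics[OF Q]] c NQ MQ
      by (intro mult_left_mono) auto
    finally have "measure M E \<le> c * measure M Q" using NQ by simp
    then have "t powr p * measure M Q \<le> B * (c * measure M Q)"
      using Ap_dyadic[OF Q E(1,2)] mult_left_mono[of "measure M E" "c * measure M Q" B] B_ge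
      unfolding t_def by linarith
    then have "t powr p \<le> B * c" using MQ by (simp add: mult.assoc[symmetric])
    then have "(t powr p) powr e \<le> (B * c) powr e"
      using C0 p_pos by (intro powr_mono2) (auto simp: e_def)
    then have "t powr d \<le> B powr e * c powr e"
      using p_pos B_ge c by (simp add: e_def powr_powr powr_mult)
    then have NE: "measure N E \<le> C0 * (B powr e * c powr e) * measure N Q"
      using C0(3)[OF Q E(1,2)] C0(1) NQ unfolding t_def[symmetric]
      by (meson mult_left_mono mult_right_mono order_trans less_imp_le)
    have "c * measure M Q / measure N Q * measure N E \<le>
        c * measure M Q / measure N Q * (C0 * (B powr e * c powr e) * measure N Q)"
      using NE c NQ MQ by (intro mult_left_mono) auto
    with ME have "measure M E \<le> c * measure M Q / measure N Q * (C0 * (B powr e * c powr e) * measure N Q)"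
      by linarith
    also have "\<dots> = C * c powr (1 + e) * measure M Q"
      using NQ c by (simp add: C_def powr_add)
    finally show "measure M (sublevel c Q) \<le> C * c powr (1 + e) * measure M Q"
      by (simp add: E_def)
  qed
qed

definition \<eta> :: real where "\<eta> = 1 - (1/2) powr p / B"

lemma \<eta>: "0 \<le> \<eta>" "\<eta> < 1"
proof -
  have "(1/2::real) powr p \<le> 1" using p_pos by (intro powr_le1) auto
  then show "0 \<le> \<eta>" using B_ge by (simp add: \<eta>_def field_simps)
  show "\<eta> < 1" using B_ge by (simp add: \<eta>_def)
qed

text \<open>Smallness passes from N to Lebesgue measure by A_1 applied to \<open>E\<close>, where
  the factor 2A yields exactly one half, and from there to M by A_p applied to \<open>Q - E\<close>.
  The complement keeps the fraction (1/2)^p / B of M(Q), which explains \<eta>.\<close>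

lemma M_le_if_N_small:
  assumes Q: "Q \<in> dyadics" and E: "E \<in> sets lebesgue" "E \<subseteq> Q"
    and small: "2 * A * measure N E \<le> measure N Q"
  shows "measure M E \<le> \<eta> * measure M Q"
proof -
  note s = E(2,1) sets_dyadics[OF Q] bounded_dyadics[OF Q]
  have lQ: "0 < measure lebesgue Q" by (rule measure_dyadics_pos[OF Q])
  have "measure lebesgue E * measure N Q \<le> A * measure N E * measure lebesgue Q"
    using A1_dyadic[OF Q E] .
  also have "\<dots> \<le> measure N Q / 2 * measure lebesgue Q"
    using small by (intro mult_right_mono) auto
  finally have "measure lebesgue E * measure N Q \<le> measure lebesgue Q / 2 * measure N Q"
    by (simp add: mult.commute)
  then have "measure lebesgue E \<le> measure lebesgue Q / 2"
    using N_pos_dyadic[OF Q] by (simp only: mult_le_cancel_right_pos)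
  then have "measure lebesgue Q / 2 \<le> measure lebesgue (Q - E)"
    using lebesgue.measure_diff_bounded[OF s] by linarith
  then have "1/2 \<le> measure lebesgue (Q - E) / measure lebesgue Q"
    using lQ by (simp add: field_simps)
  then have "(1/2) powr p * measure M Q \<le> (measure lebesgue (Q - E) / measure lebesgue Q) powr p * measure M Q"
    using p_pos by (intro mult_right_mono powr_mono2) auto
  also have "\<dots> \<le> B * measure M (Q - E)"
    using sets.Diff[OF sets_dyadics[OF Q] E(1)] by (intro Ap_dyadic[OF Q]) auto
  also have "measure M (Q - E) = measure M Q - measure M E"
    by (rule M.measure_diff_bounded[OF s])
  finally show ?thesis using B_ge by (simp add: \<eta>_def field_simps)
qed

text \<open>
  Cubes whose ratio M(Q)/N(Q) is at most \<open>a\<close> times that of \<open>P\<close> only see \<open>sublevel (s * a) P\<close>.  The maximal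
  remaining cubes occupy at most the fraction \<open>1/a\<close> of N(P), hence the fraction \<open>\<eta> < 1\<close> of M(P), which
  closes the induction.
\<close>

lemma sublevel_family_estimate:
  obtains C e where "0 < C" "0 < e" "\<And>P (F :: (real^'n) set set) s. P \<in> dyadics \<Longrightarrow> finite F \<Longrightarrow> F \<subseteq> dyadics \<Longrightarrow>
    \<Union>F \<subseteq> P \<Longrightarrow> 0 < s \<Longrightarrow>
    measure M (\<Union>Q\<in>insert P F. sublevel s Q) \<le> C * s powr (1 + e) * measure M P"
proof -
  obtain C0 e where C0: "0 < C0" "0 < e" "\<And>Q c. Q \<in> dyadics \<Longrightarrow> 0 < c \<Longrightarrow>
    measure M (sublevel c Q) \<le> C0 * c powr (1 + e) * measure M Q"
    using sublevel_estimate by metis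
  \<comment> \<open>The selected cubes will occupy at most N(P)/a, and this is the smallness that
    \<open>M_le_if_N_small\<close> asks for.\<close>
  define a where "a = 2 * A"
  have a: "1 < a" using A_ge by (simp add: a_def)
  \<comment> \<open>Fixed point of the recursion: one step costs \<open>C0 * a powr (1 + e)\<close>
    at the root and passes the constant on with factor \<eta>, see \<open>C_eq\<close>.\<close>
  define C where "C = C0 * a powr (1 + e) / (1 - \<eta>)"
  have C: "0 < C" using C0 a \<eta> by (simp add: C_def)
  have C_eq: "C0 * a powr (1 + e) + C * \<eta> = C"
    using \<eta> by (simp add: C_def field_simps)
  show ?thesis
  proof (rule that[OF C C0(2)])
    fix P and F :: "(real^'n) set set" and s :: real
    assume "P \<in> dyadics" "finite F" "F \<subseteq> dyadics" "\<Union>F \<subseteq> P" and s: "0 < s"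
    \<comment> \<open>The root is inserted and not counted, so that a cube of \<open>F\<close> can
      serve as the root in the next step.\<close>
    then show "measure M (\<Union>Q\<in>insert P F. sublevel s Q) \<le> C * s powr (1 + e) * measure M P"
    proof (induction "card F" arbitrary: P F rule: less_induct)
      case less
      note P = less.prems(1) and F = less.prems(2-4)
      have NP: "0 < measure N P" and MP: "0 < measure M P" using N_pos_dyadic M_pos_dyadic P by auto
      define F2 where "F2 = {Q\<in>F. a * measure M P * measure N Q < measure M Q * measure N P}"
      have F2: "finite F2" "F2 \<subseteq> dyadics" using F by (auto simp: F2_def)
      obtain G where G: "G \<subseteq> F2" "\<Union>G = \<Union>F2" "pairwise disjnt G"
        "\<And>Q. Q \<in> F2 \<Longrightarrow> \<exists>R\<in>G. Q \<subseteq> R"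
        using dyadics_maximal[OF F2] by metis
      have Gd: "G \<subseteq> dyadics" "finite G" "G \<subseteq> F" "\<Union>G \<subseteq> P"
      proof -
        have "F2 \<subseteq> F" by (auto simp: F2_def)
        then show GF: "G \<subseteq> F" using G(1) by blast
        then show "G \<subseteq> dyadics" "finite G" using F finite_subset by blast+
        show "\<Union>G \<subseteq> P" using GF F(3) by blast
      qed
      have Gs: "\<Union>G \<in> sets lebesgue" using Gd finite_Union_sets by blast
      \<comment> \<open>The part of the family below \<open>R\<close>. Since \<open>R\<close>
        becomes the root and is removed from the counted family, the cardinality drops.\<close>
      define S where "S R = (\<Union>Q\<in>insert R {Q\<in>F. Q \<subseteq> R \<and> Q \<noteq> R}. sublevel s Q)" for R
      have Ssets: "S R \<in> sets lebesgue" if "R \<in> F" for R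
        unfolding S_def using F that
        by (intro sets.finite_UN sets_sublevel sets_dyadics) auto
      have Sbd: "bounded (S R)" if "R \<in> F" for R
      proof (rule bounded_subset)
        show "bounded R" using that F bounded_dyadics by blast
        show "S R \<subseteq> R" using sublevel_subset by (auto simp: S_def)
      qed
      have near: "sublevel s Q \<subseteq> sublevel (s * a) P" if Q: "Q \<in> insert P F" "Q \<notin> F2" for Q
      proof
        fix x assume x: "x \<in> sublevel s Q"
        have NQ: "0 < measure N Q" using Q F P N_pos_dyadic by blast
        have "measure M Q * measure N P \<le> a * measure M P * measure N Q"
          using Q a mult_right_mono[of 1 a "measure M P * measure N P"] by (auto simp: F2_def not_less)
        then have le: "s * (measure M Q * measure N P) \<le> s * (a * measure M P * measure N Q)"
          using s by (intro mult_left_mono) auto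
        have "V x * measure N Q * measure N P < s * measure M Q * measure N P"
          using x NP by (simp add: sublevel_def)
        with le have "(V x * measure N P) * measure N Q < (s * a * measure M P) * measure N Q"
          by (simp add: algebra_simps)
        then have "V x * measure N P < s * a * measure M P"
          using NQ by (simp only: mult_less_cancel_right_pos)
        moreover have "x \<in> P" using x sublevel_subset Q F by blast
        ultimately show "x \<in> sublevel (s * a) P" by (simp add: sublevel_def)
      qed
      have far: "sublevel s Q \<subseteq> (\<Union>R\<in>G. S R)" if "Q \<in> F2" for Q
        using G(4)[OF that] that by (auto simp: S_def F2_def)
      have "(\<Union>Q\<in>insert P F. sublevel s Q) \<subseteq> sublevel (s * a) P \<union> (\<Union>R\<in>G. S R)"
        using near far by blast
      moreover have bS: "bounded (sublevel (s * a) P)"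
        using bounded_subset[OF bounded_dyadics[OF P] sublevel_subset] .
      moreover have SG: "(\<Union>R\<in>G. S R) \<in> sets lebesgue" "bounded (\<Union>R\<in>G. S R)"
        using Gd Ssets Sbd by (auto intro!: sets.finite_UN bounded_UN)
      moreover have sP: "sublevel (s * a) P \<in> sets lebesgue"
        by (rule sets_sublevel[OF sets_dyadics[OF P]])
      moreover have "(\<Union>Q\<in>insert P F. sublevel s Q) \<in> sets lebesgue"
        using P F by (intro sets.finite_UN sets_sublevel sets_dyadics) auto
      ultimately have "measure M (\<Union>Q\<in>insert P F. sublevel s Q) \<le> measure M (sublevel (s * a) P \<union> (\<Union>R\<in>G. S R))"
        by (intro M.measure_mono_bounded) (auto intro!: sets.Un)
      also have "\<dots> \<le> measure M (sublevel (s * a) P) + measure M (\<Union>R\<in>G. S R)"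
        using sP SG by (intro measure_Un_le) (auto simp: M.sets_eq)
      also have "measure M (sublevel (s * a) P) \<le> C0 * (s * a) powr (1 + e) * measure M P"
        using C0 P s a by simp
      also have "measure M (\<Union>R\<in>G. S R) \<le> (\<Sum>R\<in>G. measure M (S R))"
        using Gd Ssets by (intro measure_UNION_le) (auto simp: M.sets_eq)
      also have "\<dots> \<le> (\<Sum>R\<in>G. C * s powr (1 + e) * measure M R)"
      proof (intro sum_mono)
        fix R assume R: "R \<in> G"
        then have RF: "R \<in> F" using Gd by auto
        have "{Q \<in> F. Q \<subseteq> R \<and> Q \<noteq> R} \<subset> F" using RF by auto
        then have "card {Q \<in> F. Q \<subseteq> R \<and> Q \<noteq> R} < card F"
          using F by (intro psubset_card_mono)
        then show "measure M (S R) \<le> C * s powr (1 + e) * measure M R"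
          unfolding S_def using F RF s by (intro less.hyps) auto
      qed
      also have "\<dots> = C * s powr (1 + e) * measure M (\<Union>G)"
        using M.measure_disjoint_Union[OF Gd(2,1) G(3)] by (simp add: sum_distrib_left)
      also have "measure M (\<Union>G) \<le> \<eta> * measure M P"
      proof (rule M_le_if_N_small[OF P Gs Gd(4)])
        have "a * measure M P * measure N (\<Union>G) = (\<Sum>R\<in>G. a * measure M P * measure N R)"
          using N.measure_disjoint_Union[OF Gd(2,1) G(3)] by (simp add: sum_distrib_left)
        also have "\<dots> \<le> (\<Sum>R\<in>G. measure M R * measure N P)"
          using G by (intro sum_mono) (auto simp: F2_def)
        also have "\<dots> = measure M (\<Union>G) * measure N P"
          using M.measure_disjoint_Union[OF Gd(2,1) G(3)] by (simp add: sum_distrib_right)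
        also have "\<dots> \<le> measure M P * measure N P"
          using M.measure_mono_bounded[OF Gd(4) Gs sets_dyadics[OF P] bounded_dyadics[OF P]]
          by (intro mult_right_mono) auto
        finally have "measure M P * (a * measure N (\<Union>G)) \<le> measure M P * measure N P"
          by (simp add: algebra_simps)
        then show "2 * A * measure N (\<Union>G) \<le> measure N P"
          using MP by (simp only: mult_le_cancel_left_pos a_def)
      qed
      finally have "measure M (\<Union>Q\<in>insert P F. sublevel s Q) \<le>
          C0 * (s * a) powr (1 + e) * measure M P + C * s powr (1 + e) * (\<eta> * measure M P)"
        using C s by (auto simp: mult_left_mono)
      also have "\<dots> = (C0 * a powr (1 + e) + C * \<eta>) * s powr (1 + e) * measure M P"
        using s a by (simp add: powr_mult algebra_simps)
      finally show ?case unfolding C_eq .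
    qed
  qed
qed

text \<open>Each maximal cube of \<open>F\<close> serves as a root for the cubes inside it. These
  roots are disjoint, so their M-measures add up to that of the union.\<close>

lemma sublevel_Union_estimate:
  obtains C e where "0 < C" "0 < e" "\<And>(F :: (real^'n) set set) s. finite F \<Longrightarrow> F \<subseteq> dyadics \<Longrightarrow>
    0 < s \<Longrightarrow> measure M (\<Union>Q\<in>F. sublevel s Q) \<le> C * s powr (1 + e) * measure M (\<Union>F)"
proof -
  obtain C e where C: "0 < C" "0 < e" "\<And>P (F :: (real^'n) set set) s. P \<in> dyadics \<Longrightarrow> finite F \<Longrightarrow>
    F \<subseteq> dyadics \<Longrightarrow> \<Union>F \<subseteq> P \<Longrightarrow> 0 < s \<Longrightarrow>
    measure M (\<Union>Q\<in>insert P F. sublevel s Q) \<le> C * s powr (1 + e) * measure M P"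
    using sublevel_family_estimate by metis
  show ?thesis
  proof (rule that[OF C(1,2)])
    fix F :: "(real^'n) set set" and s :: real
    assume F: "finite F" "F \<subseteq> dyadics" and s: "0 < s"
    obtain G where G: "G \<subseteq> F" "\<Union>G = \<Union>F" "pairwise disjnt G"
      "\<And>Q. Q \<in> F \<Longrightarrow> \<exists>R\<in>G. Q \<subseteq> R"
      using dyadics_maximal[OF F] by metis
    have Gd: "G \<subseteq> dyadics" "finite G" using G(1) F finite_subset by blast+
    define S where "S R = (\<Union>Q\<in>insert R {Q\<in>F. Q \<subseteq> R}. sublevel s Q)" for R
    have Ssets: "S R \<in> sets lebesgue" if "R \<in> G" for R
      unfolding S_def using F Gd that
      by (intro sets.finite_UN sets_sublevel sets_dyadics) auto
    have SG: "(\<Union>R\<in>G. S R) \<in> sets lebesgue"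
      using Gd Ssets by (intro sets.finite_UN) auto
    have sub: "S R \<subseteq> R" for R
      using sublevel_subset by (fastforce simp: S_def)
    have bd: "bounded (\<Union>R\<in>G. S R)"
      using Gd bounded_dyadics bounded_subset[OF _ sub] by (intro bounded_UN) blast+
    have "(\<Union>Q\<in>F. sublevel s Q) \<subseteq> (\<Union>R\<in>G. S R)"
      using G(4) by (fastforce simp: S_def)
    moreover have "(\<Union>Q\<in>F. sublevel s Q) \<in> sets lebesgue"
      using F by (intro sets.finite_UN sets_sublevel sets_dyadics) auto
    ultimately have "measure M (\<Union>Q\<in>F. sublevel s Q) \<le> measure M (\<Union>R\<in>G. S R)"
      using SG bd by (intro M.measure_mono_bounded)
    also have "\<dots> \<le> (\<Sum>R\<in>G. measure M (S R))"
      using Gd Ssets by (intro measure_UNION_le) (auto simp: M.sets_eq)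
    also have "\<dots> \<le> (\<Sum>R\<in>G. C * s powr (1 + e) * measure M R)"
      unfolding S_def using F Gd s by (intro sum_mono C(3)) auto
    also have "\<dots> = C * s powr (1 + e) * measure M (\<Union>F)"
      using M.measure_disjoint_Union[OF Gd(2,1) G(3)] G(2) by (simp add: sum_distrib_left)
    finally show "measure M (\<Union>Q\<in>F. sublevel s Q) \<le> C * s powr (1 + e) * measure M (\<Union>F)" .
  qed
qed

end

section \<open>The weak-type covering estimate\<close>

text \<open>Contains every cube that meets the dyadic cube of \<open>q\<close> and has side at most \<open>dyadic_side (fst q)\<close>.\<close>

definition dyadic_enlarged :: "int \<times> (real^'n) \<Rightarrow> (real^'n) set" where
  "dyadic_enlarged q = cbox (snd q - vec (2 * dyadic_side (fst q))) (snd q + vec (2 * dyadic_side (fst q)))"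

abbreviation dyadic_at :: "int \<times> (real^'n) \<Rightarrow> (real^'n) set" where
  "dyadic_at q \<equiv> dyadic_cube (fst q) (snd q)"

lemma dyadic_enlarged_in_cubes [simp]: "dyadic_enlarged q \<in> cubes"
  unfolding dyadic_enlarged_def by (rule cubes_centeredI) simp

lemma measure_dyadic_enlarged: "measure lebesgue (dyadic_enlarged q :: (real^'n) set) = (4 * dyadic_side (fst q)) ^ CARD('n)"
proof -
  have "0 \<le> 2 * dyadic_side (fst q)" by (simp add: less_imp_le)
  then show ?thesis unfolding dyadic_enlarged_def using measure_centered_cube[of "2 * dyadic_side (fst q)" "snd q"] by simp
qed

lemma mem_centered_cube: "y \<in> cbox (x - vec r) (x + vec r) \<longleftrightarrow> (\<forall>i. \<bar>y$i - x$i\<bar> \<le> (r::real))"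
  unfolding mem_box_cart by (simp add: abs_le_iff) (smt (verit))

lemma dyadic_cube_subset_enlarged: "dyadic_at q \<subseteq> dyadic_enlarged q"
proof
  fix y assume "y \<in> dyadic_at q"
  then have "\<bar>y$i - snd q$i\<bar> \<le> 2 * dyadic_side (fst q)" for i
    using dyadic_cube_component_dist[of y "fst q" "snd q" i] dyadic_side_pos[of "fst q"] by linarith
  then show "y \<in> dyadic_enlarged q" by (simp add: dyadic_enlarged_def mem_centered_cube)
qed

text \<open>The enlargement of a cube is centred at the point that names it, so it depends on the
  pair and not on the cube alone. Naming each cube by its lower corner leaves countably many
  pairs.\<close>

lemma countable_dyadic_index:
  obtains K :: "(int \<times> (real^'n)) set" where "countable K"
    "\<And>j x. \<exists>y. (j, y) \<in> K \<and> x \<in> dyadic_cube j y"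
proof
  define pt where "pt = (\<lambda>(j, z :: int^'n). (j, (\<chi> i. of_int (z$i) * dyadic_side j) :: real^'n))"
  show "countable (range pt)" by simp
  fix j and x :: "real^'n"
  define z where "z = (\<chi> i. \<lfloor>2 powi j * x$i\<rfloor>)"
  have eq: "2 powi j * (t * dyadic_side j) = t" for t
  proof -
    have "2 powi j * dyadic_side j = 1" by (simp add: dyadic_side_def power_int_minus)
    then have "t * (2 powi j * dyadic_side j) = t" by simp
    then show ?thesis by (simp only: mult.left_commute)
  qed
  have "x \<in> dyadic_cube j (snd (pt (j, z)))"
    by (simp add: dyadic_cube_def pt_def z_def eq del: mult_eq_0_iff)
  moreover have "(j, snd (pt (j, z))) \<in> range pt"
    by (rule image_eqI[of _ _ "(j, z)"]) (auto simp: pt_def)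
  ultimately show "\<exists>y. (j, y) \<in> range pt \<and> x \<in> dyadic_cube j y" by blast
qed

lemma dyadic_scale:
  assumes "0 < r"
  obtains j where "dyadic_side j < 2 * r" "r \<le> dyadic_side j"
proof
  define k where "k = \<lceil>log 2 r\<rceil>"
  have side: "dyadic_side (- k) = 2 powr real_of_int k"
    by (simp add: dyadic_side_def powr_real_of_int')
  have "r = 2 powr (log 2 r)" using assms by simp
  also have "\<dots> \<le> 2 powr k" by (intro powr_mono) (auto simp: k_def)
  finally show "r \<le> dyadic_side (- k)" by (simp add: side)
  have "2 powr k < 2 powr (log 2 r + 1)"
    by (intro powr_less_mono) (auto simp: k_def, linarith)
  also have "\<dots> = 2 * r" using assms by (simp add: powr_add)
  finally show "dyadic_side (- k) < 2 * r" by (simp add: side)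
qed

section \<open>Doubling, Vitali selection and summation over the levels\<close>

context muckenhoupt_pair
begin

text \<open>\<open>Ap\<close> for the large cube, with the dyadic cube as the subset, is already a
  doubling inequality. The half-side 20 n times the dyadic side accommodates a ball of radius 4 n
  times that side after the fivefold Vitali enlargement.\<close>

lemma M_doubling:
  defines "n \<equiv> real CARD('n)"
  shows "measure M (cbox (x - vec (20 * n * dyadic_side j)) (x + vec (20 * n * dyadic_side j))) \<le>
    B * ((40 * n) ^ CARD('n)) powr p * measure M (dyadic_cube j x)"
proof -
  define s where "s = dyadic_side j"
  have s: "0 < s" by (simp add: s_def)
  have n: "1 \<le> n" by (simp add: n_def Suc_leI)
  define R where "R = cbox (x - vec (20 * n * s)) (x + vec (20 * n * s))"
  have R: "R \<in> cubes" unfolding R_def using s n by (intro cubes_centeredI) simp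
  have "dyadic_cube j x \<subseteq> R"
  proof
    fix y assume "y \<in> dyadic_cube j x"
    moreover have "s \<le> 20 * n * s" using s n by simp
    ultimately have "\<bar>y$i - x$i\<bar> \<le> 20 * n * s" for i
      using dyadic_cube_component_dist[of y j x i] unfolding s_def by linarith
    then show "y \<in> R" by (simp add: R_def mem_centered_cube)
  qed
  from Ap[OF R _ this] have "(measure lebesgue (dyadic_cube j x) / measure lebesgue R) powr p * measure M R
      \<le> B * measure M (dyadic_cube j x)" by simp
  moreover have "measure lebesgue (dyadic_cube j x) / measure lebesgue R = 1 / (40 * n) ^ CARD('n)"
  proof -
    have "0 \<le> 20 * n * s" using s n by simp
    from measure_centered_cube[OF this, of x] have "measure lebesgue R = (40 * n) ^ CARD('n) * s ^ CARD('n)"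
      unfolding R_def by (simp only: power_mult_distrib[symmetric]) (simp add: algebra_simps)
    then show ?thesis using s by (simp only: measure_dyadic s_def[symmetric]) simp
  qed
  moreover have "(1 / (40 * n) ^ CARD('n)) powr p = 1 / ((40 * n) ^ CARD('n)) powr p"
    using n by (simp add: powr_divide)
  moreover have "0 < ((40 * n) ^ CARD('n)) powr p" using n by simp
  ultimately show ?thesis unfolding R_def s_def by (simp add: field_simps)
qed

text \<open>The covering lemma is available for balls, so each enlarged cube is put into a ball
  \<open>rad\<close> that contains it. Disjoint balls give disjoint enlarged cubes, to which the
  bound \<open>T\<close> applies, while the fivefold balls stay in \<open>huge\<close> cubes, whose
  M-measure is controlled by doubling.\<close>

lemma Vitali_bound:
  obtains C where "0 < C" "\<And>I c T G. finite I \<Longrightarrow> 0 \<le> c \<Longrightarrow>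
    (\<And>q. q \<in> I \<Longrightarrow> measure M (dyadic_at q) \<le> c * G (dyadic_enlarged q)) \<Longrightarrow>
    (\<And>\<C>. finite \<C> \<Longrightarrow> \<C> \<subseteq> cubes \<Longrightarrow> pairwise disjnt \<C> \<Longrightarrow> (\<Sum>Q\<in>\<C>. G Q) \<le> (T::real)) \<Longrightarrow>
    measure M (\<Union>q\<in>I. dyadic_at q) \<le> C * c * T"
proof -
  define n where "n = real CARD('n)"
  have n: "1 \<le> n" by (simp add: n_def Suc_leI)
  define C where "C = B * ((40 * n) ^ CARD('n)) powr p"
  have C: "0 < C" using B_ge n by (simp add: C_def)
  define rad where "rad q = 4 * n * dyadic_side (fst q)" for q :: "int \<times> (real^'n)"
  define huge where "huge q = cbox (snd q - vec (20 * n * dyadic_side (fst q))) (snd q + vec (20 * n * dyadic_side (fst q)))"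
    for q :: "int \<times> (real^'n)"
  have rad: "0 < rad q" for q using n by (simp add: rad_def)
  have big_ball: "dyadic_enlarged q \<subseteq> cball (snd q) (rad q)" for q
  proof
    fix y assume "y \<in> dyadic_enlarged q"
    then have y: "\<bar>y$i - snd q$i\<bar> \<le> 2 * dyadic_side (fst q)" for i by (simp add: dyadic_enlarged_def mem_centered_cube)
    have "norm (y - snd q) \<le> (\<Sum>i\<in>UNIV. \<bar>(y - snd q)$i\<bar>)" by (rule norm_le_l1_cart)
    also have "\<dots> \<le> (\<Sum>i\<in>(UNIV::'n set). 2 * dyadic_side (fst q))"
      using y by (intro sum_mono) auto
    also have "\<dots> \<le> rad q" using n by (simp add: rad_def n_def)
    finally show "y \<in> cball (snd q) (rad q)" by (simp add: dist_norm norm_minus_commute)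
  qed
  have ball_huge: "cball (snd q) (5 * rad q) \<subseteq> huge q" for q
  proof
    fix y assume "y \<in> cball (snd q) (5 * rad q)"
    then have "norm (y - snd q) \<le> 20 * n * dyadic_side (fst q)"
      by (simp add: rad_def dist_norm norm_minus_commute)
    then have "\<bar>(y - snd q)$i\<bar> \<le> 20 * n * dyadic_side (fst q)" for i
      using component_le_norm_cart order_trans by blast
    then show "y \<in> huge q" by (simp add: huge_def mem_centered_cube)
  qed
  have huge: "huge q \<in> cubes" for q
    unfolding huge_def using n by (intro cubes_centeredI) simp
  show ?thesis
  proof (rule that[OF C])
    fix I c T G
    assume I: "finite I" and c: "0 \<le> (c::real)"
      and le: "\<And>q. q \<in> I \<Longrightarrow> measure M (dyadic_at q) \<le> c * G (dyadic_enlarged q)"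
      and T: "\<And>\<C>. finite \<C> \<Longrightarrow> \<C> \<subseteq> cubes \<Longrightarrow> pairwise disjnt \<C> \<Longrightarrow> (\<Sum>Q\<in>\<C>. G Q) \<le> (T::real)"
    define S where "S = (\<Union>q\<in>I. dyadic_at q)"
    have S: "S \<subseteq> (\<Union>q\<in>I. cball (snd q) (rad q))"
      using dyadic_cube_subset_enlarged big_ball unfolding S_def by blast
    \<comment> \<open>The covering lemma needs bounded radii, and the finite family provides a
      maximum.\<close>
    have rb: "0 < rad q \<and> rad q \<le> Max (rad ` I)" if "q \<in> I" for q
      using rad that I by simp
    obtain J where J: "countable J" "J \<subseteq> I"
      "pairwise (\<lambda>q q'. disjnt (cball (snd q) (rad q)) (cball (snd q') (rad q'))) J"
      "S \<subseteq> (\<Union>q\<in>J. cball (snd q) (5 * rad q))"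
      by (rule Vitali_covering_lemma_cballs[OF S rb]) (assumption, rule that)
    have fJ: "finite J" using J(2) I finite_subset by blast
    have dis: "disjnt (dyadic_enlarged q) (dyadic_enlarged q')" if "q \<in> J" "q' \<in> J" "q \<noteq> q'" for q q'
      using pairwiseD[OF J(3) that] disjnt_subset1[OF _ big_ball[of q]] disjnt_subset2[OF _ big_ball[of q']] by blast
    have ne: "snd q \<in> dyadic_enlarged q" for q :: "int \<times> (real^'n)"
      using dyadic_cube_subset_enlarged mem_dyadic_cube_self by blast
    \<comment> \<open>The bound \<open>T\<close> concerns sums over sets of cubes, so no cube may
      arise from two indices; disjoint nonempty cubes are distinct.\<close>
    have inj: "inj_on dyadic_enlarged J"
      using dis ne by (intro inj_onI) (metis disjnt_iff)
    have "S \<subseteq> (\<Union>q\<in>J. huge q)" using J(4) ball_huge by blast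
    moreover have "S \<in> sets lebesgue" unfolding S_def using I by (intro sets.finite_UN) auto
    moreover have "(\<Union>q\<in>J. huge q) \<in> sets lebesgue" using fJ huge by (intro sets.finite_UN) auto
    moreover have "bounded (\<Union>q\<in>J. huge q)" using fJ huge bounded_cubes by (intro bounded_UN) auto
    ultimately have "measure M S \<le> measure M (\<Union>q\<in>J. huge q)" by (rule M.measure_mono_bounded)
    also have "\<dots> \<le> (\<Sum>q\<in>J. measure M (huge q))"
      using fJ huge by (intro measure_UNION_le) (auto simp: M.sets_eq)
    also have "\<dots> \<le> (\<Sum>q\<in>J. C * (c * G (dyadic_enlarged q)))"
    proof (intro sum_mono)
      fix q assume "q \<in> J"
      then have "C * measure M (dyadic_at q) \<le> C * (c * G (dyadic_enlarged q))"
        using le[OF subsetD[OF J(2)]] C by (intro mult_left_mono) (simp_all add: less_imp_le)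
      then show "measure M (huge q) \<le> C * (c * G (dyadic_enlarged q))"
        using M_doubling[of "snd q" "fst q"] unfolding huge_def C_def n_def by linarith
    qed
    also have "\<dots> = C * c * (\<Sum>Q\<in>dyadic_enlarged ` J. G Q)"
      by (simp add: sum.reindex[OF inj] sum_distrib_left mult.assoc)
    also have "\<dots> \<le> C * c * T"
      using C c dis fJ by (intro mult_left_mono T) (auto simp: pairwise_image pairwise_def)
    finally show "measure M (\<Union>q\<in>I. dyadic_at q) \<le> C * c * T" by (simp add: S_def)
  qed
qed

text \<open>Only monotonicity of \<open>G\<close> and its bounded sums over disjoint cubes are left
  of the functions f_i. The set to be estimated is a union over uncountably many cubes; it is
  enclosed in a measurable \<open>E\<close>, which avoids the question of its own
  measurability.\<close>

lemma weak_type: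
  obtains C where "0 < C" "\<And>(G :: (real^'n) set \<Rightarrow> real) T. (\<And>Q. Q \<in> cubes \<Longrightarrow> 0 \<le> G Q) \<Longrightarrow>
    (\<And>Q R. Q \<in> cubes \<Longrightarrow> R \<in> cubes \<Longrightarrow> Q \<subseteq> R \<Longrightarrow> G Q \<le> G R) \<Longrightarrow>
    (\<And>\<C>. finite \<C> \<Longrightarrow> \<C> \<subseteq> cubes \<Longrightarrow> pairwise disjnt \<C> \<Longrightarrow> (\<Sum>Q\<in>\<C>. G Q) \<le> (T::real)) \<Longrightarrow>
    \<exists>E\<in>sets lebesgue. {x. \<exists>Q\<in>cubes. x \<in> Q \<and> V x * measure N Q < G Q} \<subseteq> E \<and>
      emeasure M E \<le> ennreal (C * T)"
proof -
  obtain C0 e where C0: "0 < C0" "0 < e" and subl: "\<And>(F :: (real^'n) set set) s. finite F \<Longrightarrow>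
    F \<subseteq> dyadics \<Longrightarrow> 0 < s \<Longrightarrow>
    measure M (\<Union>Q\<in>F. sublevel s Q) \<le> C0 * s powr (1 + e) * measure M (\<Union>F)"
    using sublevel_Union_estimate by metis
  \<comment> \<open>The 1 serves level 0, where M(Q) has no lower bound and the whole cubes are
    taken. The factor \<open>2 powr (1 + e)\<close> comes from the sublevel constant 2 / 2^l of the
    other levels.\<close>
  define C1 where "C1 = max 1 (C0 * 2 powr (1 + e))"
  \<comment> \<open>Bounds N of an enlarged dyadic cube by N(Q): the enlargement has four times the
    dyadic side, hence less than 8 times the side of Q, and \<open>A1\<close> converts the volume
    ratio.\<close>
  define \<kappa> where "\<kappa> = A * 8 ^ CARD('n)"
  have \<kappa>: "0 < \<kappa>" using A_ge by (simp add: \<kappa>_def)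
  \<comment> \<open>Ratio of the geometric series: the factor 2^l from Vitali times 2^(-l(1+e)) from
    the sublevel estimate.\<close>
  define \<theta> where "\<theta> = (1/2) powr e"
  have \<theta>: "0 < \<theta>" "\<theta> < 1" using C0(2) powr_less_mono2[of e "1/2" 1] by (auto simp: \<theta>_def)
  show ?thesis
  proof (rule Vitali_bound)
    fix CV
    assume CV: "0 < CV" and Vitali: "\<And>(I :: (int \<times> (real^'n)) set) c T G. finite I \<Longrightarrow> 0 \<le> c \<Longrightarrow>
      (\<And>q. q \<in> I \<Longrightarrow> measure M (dyadic_at q) \<le> c * G (dyadic_enlarged q)) \<Longrightarrow>
      (\<And>\<C>. finite \<C> \<Longrightarrow> \<C> \<subseteq> cubes \<Longrightarrow> pairwise disjnt \<C> \<Longrightarrow> (\<Sum>Q\<in>\<C>. G Q) \<le> (T::real)) \<Longrightarrow>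
      measure M (\<Union>q\<in>I. dyadic_at q) \<le> CV * c * T"
    define C where "C = C1 * CV * \<kappa> / (1 - \<theta>)"
    have C: "0 < C" using CV \<kappa> \<theta> by (simp add: C_def C1_def)
    show ?thesis
    proof (rule that[OF C])
      fix G :: "(real^'n) set \<Rightarrow> real" and T :: real
      assume G0: "\<And>Q. Q \<in> cubes \<Longrightarrow> 0 \<le> G Q"
        and Gmono: "\<And>Q R. Q \<in> cubes \<Longrightarrow> R \<in> cubes \<Longrightarrow> Q \<subseteq> R \<Longrightarrow> G Q \<le> G R"
        and GT: "\<And>\<C>. finite \<C> \<Longrightarrow> \<C> \<subseteq> cubes \<Longrightarrow> pairwise disjnt \<C> \<Longrightarrow> (\<Sum>Q\<in>\<C>. G Q) \<le> T"
      have T: "0 \<le> T" using GT[of "{}"] by simp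
      \<comment> \<open>The condition at \<open>x\<close> moved from an arbitrary cube to a dyadic
        one: N(Q) loses at most the factor \<kappa>, and \<open>G\<close> only grows when Q is
        replaced by the enlargement.\<close>
      define S where "S q = {x\<in>dyadic_at q. V x * measure N (dyadic_at q) < \<kappa> * G (dyadic_enlarged q)}" for q
      have S_sets: "S q \<in> sets lebesgue" for q
        unfolding S_def by (intro sets_V_less sets_dyadics dyadic_cube_in_dyadics)
      have S_sub: "S q \<subseteq> dyadic_at q" for q
        by (auto simp: S_def)
      have S_bd: "bounded (S q)" for q
        using bounded_subset[OF bounded_dyadics[OF dyadic_cube_in_dyadics] S_sub] .

      have finite_bound: "measure M (\<Union>q\<in>I. S q) \<le> C * T" if I: "finite I" for I
      proof -
        \<comment> \<open>The level index compares M with G and needs G to be positive. Where G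
          vanishes there is nothing to estimate, as V \<ge> 0 makes \<open>S q\<close>
          empty.\<close>
        define I' where "I' = {q\<in>I. 0 < G (dyadic_enlarged q)}"
        have I': "finite I'" using I by (simp add: I'_def)
        have S_empty: "S q = {}" if "q \<in> I - I'" for q
        proof -
          have "G (dyadic_enlarged q) = 0" using that G0[of "dyadic_enlarged q"] by (force simp: I'_def)
          moreover have "0 \<le> V x * measure N (dyadic_at q)" for x by (simp add: V_nonneg)
          ultimately show ?thesis by (auto simp: S_def not_less)
        qed
        define H where "H q = \<kappa> * G (dyadic_enlarged q)" for q
        have H: "0 < H q" if "q \<in> I'" for q using that \<kappa> by (simp add: H_def I'_def)
        \<comment> \<open>All cubes with M(Q) \<le> H share level 0. At positive levels minimality
          gives the reverse bound \<open>L2\<close>, which is what places \<open>S q\<close> in a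
          sublevel set.\<close>
        define L where "L q = (LEAST l. measure M (dyadic_at q) \<le> 2 ^ l * H q)" for q
        have L1: "measure M (dyadic_at q) \<le> 2 ^ L q * H q" if "q \<in> I'" for q
        proof -
          obtain l where "measure M (dyadic_at q) / H q < 2 ^ l" using real_arch_pow[of 2] by auto
          then have "measure M (dyadic_at q) \<le> 2 ^ l * H q" using H[OF that] by (simp add: field_simps)
          then show ?thesis unfolding L_def by (rule LeastI)
        qed
        have L2: "2 ^ L q * H q < 2 * measure M (dyadic_at q)" if "0 < L q" for q
        proof -
          obtain l where l: "L q = Suc l" using \<open>0 < L q\<close> gr0_implies_Suc by blast
          then have "\<not> measure M (dyadic_at q) \<le> 2 ^ l * H q"
            using not_less_Least[of l "\<lambda>l. measure M (dyadic_at q) \<le> 2 ^ l * H q"] by (simp add: L_def)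
          then show ?thesis by (simp add: l)
        qed
        define J where "J l = {q\<in>I'. L q = l}" for l
        have J: "finite (J l)" "J l \<subseteq> I'" for l using I' by (auto simp: J_def)
        have level: "measure M (\<Union>q\<in>J l. S q) \<le> C1 * CV * \<kappa> * T * \<theta> ^ l" for l
        proof -
          have "measure M (\<Union>q\<in>J l. dyadic_at q) \<le> CV * (2 ^ l * \<kappa>) * T"
          proof (rule Vitali[OF J(1)])
            show "measure M (dyadic_at q) \<le> (2 ^ l * \<kappa>) * G (dyadic_enlarged q)" if "q \<in> J l" for q
              using L1[of q] that by (simp add: J_def H_def mult.assoc)
          qed (use \<kappa> GT in auto)
          moreover have "measure M (\<Union>q\<in>J l. S q) \<le> C1 * (1 / 2 ^ l) powr (1 + e) * measure M (\<Union>q\<in>J l. dyadic_at q)"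
          proof (cases "l = 0")
            case True
            have "measure M (\<Union>q\<in>J l. S q) \<le> measure M (\<Union>q\<in>J l. dyadic_at q)"
            proof (rule M.measure_mono_bounded)
              show "(\<Union>q\<in>J l. S q) \<subseteq> (\<Union>q\<in>J l. dyadic_at q)" using S_sub by blast
              show "(\<Union>q\<in>J l. S q) \<in> sets lebesgue" using J S_sets by (intro sets.finite_UN) auto
              show "(\<Union>q\<in>J l. dyadic_at q) \<in> sets lebesgue" using J by (intro sets.finite_UN) auto
              show "bounded (\<Union>q\<in>J l. dyadic_at q)" using J by (intro bounded_UN ballI bounded_dyadics) auto
            qed
            also have "\<dots> \<le> C1 * measure M (\<Union>q\<in>J l. dyadic_at q)"
              using mult_right_mono[of 1 C1 "measure M (\<Union>q\<in>J l. dyadic_at q)"] by (simp add: C1_def)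
            finally show ?thesis using True by simp
          next
            case False
            have "S q \<subseteq> sublevel (2 / 2 ^ l) (dyadic_at q)" if "q \<in> J l" for q
            proof
              fix x assume x: "x \<in> S q"
              have "2 ^ l * H q < 2 * measure M (dyadic_at q)"
                using L2[of q] that False by (simp add: J_def)
              then have "H q < 2 / 2 ^ l * measure M (dyadic_at q)"
                by (simp add: field_simps)
              then show "x \<in> sublevel (2 / 2 ^ l) (dyadic_at q)"
                using x by (auto simp: S_def sublevel_def H_def)
            qed
            then have "(\<Union>q\<in>J l. S q) \<subseteq> (\<Union>Q\<in>dyadic_at ` J l. sublevel (2 / 2 ^ l) Q)"
              by blast
            moreover have "(\<Union>q\<in>J l. S q) \<in> sets lebesgue"
              using J S_sets by (intro sets.finite_UN) auto
            moreover have "(\<Union>Q\<in>dyadic_at ` J l. sublevel (2 / 2 ^ l) Q) \<in> sets lebesgue"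
              using J by (intro sets.finite_UN sets_sublevel) auto
            moreover have "bounded (\<Union>Q\<in>dyadic_at ` J l. sublevel (2 / 2 ^ l) Q)"
              using J bounded_subset[OF bounded_dyadics sublevel_subset] by (intro bounded_UN) auto
            ultimately have "measure M (\<Union>q\<in>J l. S q) \<le> measure M (\<Union>Q\<in>dyadic_at ` J l. sublevel (2 / 2 ^ l) Q)"
              by (rule M.measure_mono_bounded)
            also have "\<dots> \<le> C0 * (2 / 2 ^ l) powr (1 + e) * measure M (\<Union>(dyadic_at ` J l))"
              using J by (intro subl) auto
            also have "\<dots> = (C0 * 2 powr (1 + e)) * ((1 / 2 ^ l) powr (1 + e) * measure M (\<Union>(dyadic_at ` J l)))"
              by (simp add: powr_divide)
            also have "\<dots> \<le> C1 * ((1 / 2 ^ l) powr (1 + e) * measure M (\<Union>(dyadic_at ` J l)))"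
              by (intro mult_right_mono) (auto simp: C1_def)
            finally show ?thesis by (simp add: mult.assoc)
          qed
          moreover have "0 \<le> C1 * (1 / 2 ^ l) powr (1 + e)" by (simp add: C1_def)
          ultimately have "measure M (\<Union>q\<in>J l. S q) \<le> C1 * (1 / 2 ^ l) powr (1 + e) * (CV * (2 ^ l * \<kappa>) * T)"
            by (meson mult_left_mono order_trans)
          also have "(1 / 2 ^ l) powr (1 + e) = 1 / 2 ^ l * \<theta> ^ l"
          proof -
            have "(1 / 2 ^ l) powr e = ((1/2) powr real l) powr e"
              by (simp add: powr_realpow power_one_over)
            also have "\<dots> = \<theta> ^ l"
              by (simp add: \<theta>_def powr_powr powr_power mult.commute)
            finally have "(1 / 2 ^ l) powr e = \<theta> ^ l" .
            then show ?thesis by (simp add: powr_add)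
          qed
          finally show ?thesis by (simp add: mult_ac)
        qed
        have "(\<Union>q\<in>I. S q) = (\<Union>l\<in>L ` I'. \<Union>q\<in>J l. S q)"
        proof (intro equalityI UN_least)
          fix q assume "q \<in> I"
          show "S q \<subseteq> (\<Union>l\<in>L ` I'. \<Union>q\<in>J l. S q)"
          proof (cases "q \<in> I'")
            case True
            then have "q \<in> J (L q)" by (simp add: J_def)
            with True show ?thesis by blast
          next
            case False
            then show ?thesis using S_empty \<open>q \<in> I\<close> by simp
          qed
        next
          fix l q assume "q \<in> J l"
          then have "q \<in> I" using J(2) by (auto simp: I'_def)
          then show "S q \<subseteq> (\<Union>q\<in>I. S q)" by blast
        qed
        then have "measure M (\<Union>q\<in>I. S q) = measure M (\<Union>l\<in>L ` I'. \<Union>q\<in>J l. S q)" by simp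
        also have "\<dots> \<le> (\<Sum>l\<in>L ` I'. measure M (\<Union>q\<in>J l. S q))"
          using I' J S_sets by (intro measure_UNION_le) (auto simp: M.sets_eq)
        also have "\<dots> \<le> (\<Sum>l\<in>L ` I'. C1 * CV * \<kappa> * T * \<theta> ^ l)"
          by (intro sum_mono level)
        also have "\<dots> = C1 * CV * \<kappa> * T * (\<Sum>l\<in>L ` I'. \<theta> ^ l)"
          by (simp add: sum_distrib_left)
        also have "\<dots> \<le> C1 * CV * \<kappa> * T * (1 / (1 - \<theta>))"
        proof (rule mult_left_mono)
          have "(\<Sum>l\<in>L ` I'. \<theta> ^ l) \<le> (\<Sum>l. \<theta> ^ l)"
            using I' \<theta> by (intro sum_le_suminf summable_geometric) auto
          then show "(\<Sum>l\<in>L ` I'. \<theta> ^ l) \<le> 1 / (1 - \<theta>)"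
            using \<theta> by (simp add: suminf_geometric)
          show "0 \<le> C1 * CV * \<kappa> * T" using CV \<kappa> T by (simp add: C1_def)
        qed
        also have "\<dots> = C * T" by (simp add: C_def)
        finally show ?thesis .
      qed

      show "\<exists>E\<in>sets lebesgue. {x. \<exists>Q\<in>cubes. x \<in> Q \<and> V x * measure N Q < G Q} \<subseteq> E \<and>
          emeasure M E \<le> ennreal (C * T)"
      proof (rule countable_dyadic_index)
        fix K :: "(int \<times> (real^'n)) set"
        assume K: "countable K" and cover: "\<And>j x. \<exists>y. (j, y) \<in> K \<and> x \<in> dyadic_cube j y"
        have Kne: "K \<noteq> {}" using cover by blast
        \<comment> \<open>An increasing sequence of finite unions exhausts the countable index set,
          so the finite bound survives by continuity from below.\<close>
        define E where "E = (\<Union>i::nat. \<Union>q\<in>from_nat_into K ` {..i}. S q)"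
        have E_sets: "(\<Union>q\<in>from_nat_into K ` {..i}. S q) \<in> sets lebesgue" for i
          using S_sets by (intro sets.finite_UN) auto
        have "emeasure M E = (SUP i. emeasure M (\<Union>q\<in>from_nat_into K ` {..i}. S q))"
          unfolding E_def
        proof (rule SUP_emeasure_incseq[symmetric])
          show "range (\<lambda>i. \<Union>q\<in>from_nat_into K ` {..i}. S q) \<subseteq> sets M"
            using E_sets M.sets_eq by auto
          show "incseq (\<lambda>i. \<Union>q\<in>from_nat_into K ` {..i}. S q)"
            unfolding incseq_def by (intro allI impI UN_mono image_mono) auto
        qed
        also have "\<dots> \<le> ennreal (C * T)"
        proof (rule SUP_least)
          fix i
          have "bounded (\<Union>q\<in>from_nat_into K ` {..i}. S q)"
            using S_bd by (intro bounded_UN) auto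
          then have "emeasure M (\<Union>q\<in>from_nat_into K ` {..i}. S q) =
              measure M (\<Union>q\<in>from_nat_into K ` {..i}. S q)"
            by (intro emeasure_eq_measure2 M.fmeasurable_bounded E_sets)
          also have "\<dots> \<le> ennreal (C * T)"
            by (intro ennreal_leI finite_bound) simp
          finally show "emeasure M (\<Union>q\<in>from_nat_into K ` {..i}. S q) \<le> ennreal (C * T)" .
        qed
        finally have "emeasure M E \<le> ennreal (C * T)" .
        moreover have "E \<in> sets lebesgue" unfolding E_def using E_sets by blast
        moreover have "x \<in> E" if Q: "Q \<in> cubes" "x \<in> Q" "V x * measure N Q < G Q" for x Q
        proof -
          obtain a r where ar: "Q = cbox a (a + vec r)" "0 < r" using Q(1) by (auto simp: cubes_def)
          \<comment> \<open>The lower bound on the dyadic side makes the enlargement contain Q,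
            since distances are below r plus the side; the upper bound keeps the enlargement
            comparable to Q.\<close>
          obtain j where j: "dyadic_side j < 2 * r" "r \<le> dyadic_side j" using dyadic_scale[OF ar(2)] by metis
          obtain y where y: "(j, y) \<in> K" "x \<in> dyadic_cube j y" using cover by blast
          define q where "q = (j, y)"
          have QP: "Q \<subseteq> dyadic_enlarged q"
          proof
            fix z assume z: "z \<in> Q"
            have "\<bar>z$i - y$i\<bar> \<le> 2 * dyadic_side j" for i
            proof -
              have "a$i \<le> z$i" "z$i \<le> a$i + r" "a$i \<le> x$i" "x$i \<le> a$i + r"
                using z Q(2) by (auto simp: ar mem_box_cart)
              then show ?thesis using dyadic_cube_component_dist[OF y(2), of i] j(2) by linarith
            qed
            then show "z \<in> dyadic_enlarged q" by (simp add: dyadic_enlarged_def q_def mem_centered_cube)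
          qed
          have "measure N (dyadic_at q) \<le> measure N (dyadic_enlarged q)"
            by (intro N.measure_mono_bounded dyadic_cube_subset_enlarged bounded_cubes) auto
          also have "\<dots> \<le> \<kappa> * measure N Q"
          proof -
            have lQ: "measure lebesgue Q = r ^ CARD('n)"
              using measure_cube[of r a] ar by simp
            have "measure lebesgue (dyadic_enlarged q) \<le> (8 * r) ^ CARD('n)"
              unfolding measure_dyadic_enlarged q_def using j(1) dyadic_side_pos[of j]
              by (intro power_mono) (simp_all add: less_imp_le)
            then have le: "measure lebesgue (dyadic_enlarged q) \<le> 8 ^ CARD('n) * measure lebesgue Q"
              by (simp only: lQ power_mult_distrib)
            have "measure lebesgue Q * measure N (dyadic_enlarged q) \<le> A * measure N Q * measure lebesgue (dyadic_enlarged q)"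
              using QP Q(1) by (intro A1) auto
            also have "\<dots> \<le> A * measure N Q * (8 ^ CARD('n) * measure lebesgue Q)"
              using A_ge by (intro mult_left_mono le) auto
            finally have "measure lebesgue Q * measure N (dyadic_enlarged q) \<le> measure lebesgue Q * (\<kappa> * measure N Q)"
              by (simp add: \<kappa>_def algebra_simps)
            moreover have "0 < measure lebesgue Q" unfolding lQ using ar(2) by simp
            ultimately show ?thesis by (simp only: mult_le_cancel_left_pos)
          qed
          finally have "V x * measure N (dyadic_at q) \<le> V x * (\<kappa> * measure N Q)"
            using V_nonneg by (intro mult_left_mono)
          also have "\<dots> = \<kappa> * (V x * measure N Q)" by simp
          also have "\<dots> < \<kappa> * G Q" using Q(3) \<kappa> by simp
          also have "\<dots> \<le> \<kappa> * G (dyadic_enlarged q)" using Gmono[OF Q(1) _ QP] \<kappa> by simp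
          finally have "x \<in> S q" using y by (simp add: S_def q_def)
          moreover have "q \<in> range (from_nat_into K)"
            using range_from_nat_into[OF Kne K] y by (simp add: q_def)
          ultimately show ?thesis by (auto simp: E_def)
        qed
        ultimately show ?thesis by blast
      qed
    qed
  qed
qed

end

section \<open>Weights\<close>

lemma measure_cube_pos: "Q \<in> cubes \<Longrightarrow> 0 < measure lebesgue (Q :: (real^'n) set)"
  unfolding cubes_def using measure_cube by (smt (verit) mem_Collect_eq zero_less_power)

lemma emeasure_cube:
  "Q \<in> cubes \<Longrightarrow> emeasure lebesgue (Q :: (real^'n) set) = ennreal (measure lebesgue Q)"
  using emeasure_eq_measure2[OF lebesgue.fmeasurable_bounded[OF sets_cubes bounded_cubes]] by blast

lemma bounded_in_cube:
  assumes "bounded (S :: (real^'n) set)"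
  obtains Q where "Q \<in> cubes" "S \<subseteq> Q"
proof -
  obtain b where b: "0 < b" "\<And>x. x \<in> S \<Longrightarrow> norm x \<le> b"
    using assms bounded_pos by blast
  have "S \<subseteq> cbox (0 - vec b) (0 + vec b)"
  proof
    fix x assume "x \<in> S"
    then have "\<bar>x$i\<bar> \<le> b" for i using b component_le_norm_cart order_trans by blast
    then show "x \<in> cbox (0 - vec b) (0 + vec b)" unfolding mem_centered_cube by simp
  qed
  then show ?thesis using that cubes_centeredI[OF b(1)] by blast
qed

lemma bounded_finite_measure_density:
  fixes f :: "real^'n \<Rightarrow> ennreal"
  assumes f: "f \<in> borel_measurable lebesgue"
    and fin: "\<And>Q. Q \<in> cubes \<Longrightarrow> (\<integral>\<^sup>+x\<in>Q. f x \<partial>lebesgue) < \<infinity>"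
  shows "bounded_finite_measure (density lebesgue f)"
proof
  show "sets (density lebesgue f) = sets lebesgue" by simp
  show "null_sets lebesgue \<subseteq> null_sets (density lebesgue f)"
    using absolutely_continuousI_density[OF f] by (simp add: absolutely_continuous_def)
  fix S :: "(real^'n) set" assume S: "bounded S" "S \<in> sets lebesgue"
  obtain Q where Q: "Q \<in> cubes" "S \<subseteq> Q" using bounded_in_cube[OF S(1)] by blast
  have "emeasure (density lebesgue f) S \<le> emeasure (density lebesgue f) Q"
    using Q S by (intro emeasure_mono) auto
  also have "\<dots> < \<infinity>" using fin[OF Q(1)] Q f by (simp add: emeasure_density)
  finally show "emeasure (density lebesgue f) S < \<infinity>" .
qed

lemma density_pos:
  assumes f: "f \<in> borel_measurable M" and pos: "AE x in M. 0 < f x"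
    and S: "S \<in> sets M" "0 < emeasure M S"
  shows "0 < emeasure (density M f) S"
proof (rule ccontr)
  assume "\<not> 0 < emeasure (density M f) S"
  then have "S \<in> null_sets (density M f)" using S by (auto simp: null_sets_def)
  then have "AE x in M. x \<in> S \<longrightarrow> f x = 0" by (simp add: null_sets_density_iff f)
  with pos have "AE x in M. x \<notin> S" by eventually_elim auto
  then have "emeasure M S = 0" using S AE_iff_null_sets[OF S(1)] by auto
  with S show False by simp
qed

text \<open>Measurability is extracted from local integrability: the truncations to the balls
  \<open>cball 0 n\<close> are integrable and are eventually constant at each point.\<close>

lemma weight_measurable:
  assumes "weight (w :: real^'n \<Rightarrow> real)"
  shows "w \<in> borel_measurable lebesgue"
proof (rule borel_measurable_LIMSEQ_real)
  show "(\<lambda>x. indicat_real (cball 0 (real n)) x *\<^sub>R w x) \<in> borel_measurable lebesgue" for n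
    using assms unfolding weight_def set_integrable_def
    by (intro borel_measurable_integrable) (simp add: compact_cball)
  fix x :: "real^'n"
  have "\<forall>\<^sub>F n in sequentially. indicat_real (cball 0 (real n)) x *\<^sub>R w x = w x"
    using eventually_ge_at_top[of "nat \<lceil>norm x\<rceil>"]
    by eventually_elim (auto simp: indicator_def nat_le_iff ceiling_le_iff)
  then show "(\<lambda>n. indicat_real (cball 0 (real n)) x *\<^sub>R w x) \<longlonglongrightarrow> w x"
    by (rule tendsto_eventually)
qed

lemma weight_cube_finite:
  assumes w: "weight (w :: real^'n \<Rightarrow> real)" and Q: "Q \<in> cubes"
  shows "(\<integral>\<^sup>+x\<in>Q. ennreal (w x) \<partial>lebesgue) < \<infinity>"
proof -
  have "compact Q" using Q by (auto simp: cubes_def)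
  then have "integrable lebesgue (\<lambda>x. indicat_real Q x *\<^sub>R w x)"
    using w by (simp add: weight_def set_integrable_def)
  then have "(\<integral>\<^sup>+x. ennreal (norm (indicat_real Q x *\<^sub>R w x)) \<partial>lebesgue) < \<infinity>"
    by (simp add: integrable_iff_bounded)
  also have "(\<integral>\<^sup>+x. ennreal (norm (indicat_real Q x *\<^sub>R w x)) \<partial>lebesgue) = (\<integral>\<^sup>+x\<in>Q. ennreal (w x) \<partial>lebesgue)"
    using w by (intro nn_integral_cong) (auto simp: indicator_def weight_def)
  finally show ?thesis .
qed

text \<open>Exceptional null sets may be united only countably often, so the supremum over all lower
  bounds is first written as that of a sequence.\<close>

lemma AE_ess_inf_on:
  "AE x in lebesgue. x \<in> Q \<longrightarrow> ess_inf_on Q g \<le> g x"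
proof -
  define A where "A = {c. AE x in lebesgue. x \<in> Q \<longrightarrow> c \<le> g x}"
  have "0 \<in> A" by (simp add: A_def)
  then obtain c where c: "range c \<subseteq> A" "Sup A = (SUP i::nat. c i)"
    using ennreal_Sup_countable_SUP[of A] by blast
  then have "AE x in lebesgue. x \<in> Q \<longrightarrow> c i \<le> g x" for i by (auto simp: A_def)
  then have "AE x in lebesgue. \<forall>i. x \<in> Q \<longrightarrow> c i \<le> g x"
    unfolding AE_all_countable by blast
  then show ?thesis
    by eventually_elim (use c in \<open>auto simp: ess_inf_on_def A_def intro: SUP_least\<close>)
qed

text \<open>This is Hoelder's inequality with m exponents equal to m. After dividing
  \<open>a i j\<close> by its sum \<open>S i\<close> over j, AM-GM bounds each root by a mean of m
  fractions, and for each i these fractions sum to 1. If some \<open>S i\<close> is zero, every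
  product vanishes.\<close>

lemma sum_root_prod_le:
  fixes a :: "nat \<Rightarrow> 'a \<Rightarrow> real"
  assumes m: "1 \<le> m" and J: "finite J" and a: "\<And>i j. 0 \<le> a i j"
  shows "(\<Sum>j\<in>J. (\<Prod>i=1..m. a i j) powr (1 / m)) \<le> (\<Prod>i=1..m. \<Sum>j\<in>J. a i j) powr (1 / m)"
proof (cases "\<exists>i\<in>{1..m}. (\<Sum>j\<in>J. a i j) = 0")
  case True
  then obtain i where i: "i \<in> {1..m}" "(\<Sum>j\<in>J. a i j) = 0" by blast
  then have "\<forall>j\<in>J. a i j = 0" using J a by (simp add: sum_nonneg_eq_0_iff)
  then have z: "(\<Prod>i=1..m. a i j) = 0" if "j \<in> J" for j
    using i that by (intro prod_zero) auto
  have "(\<Sum>j\<in>J. (\<Prod>i=1..m. a i j) powr (1 / m)) = 0"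
    by (intro sum.neutral ballI) (simp only: z powr_zero_eq_one powr_0)
  then show ?thesis by simp
next
  case False
  define S where "S i = (\<Sum>j\<in>J. a i j)" for i
  have S: "0 < S i" if "i \<in> {1..m}" for i
    using False that a by (auto simp: S_def less_le sum_nonneg)
  have PS: "0 < (\<Prod>i=1..m. S i)" using S by (intro prod_pos) auto
  have "(\<Prod>i=1..m. a i j) powr (1 / m) \<le> (\<Prod>i=1..m. S i) powr (1 / m) * (\<Sum>i=1..m. a i j / S i / m)" for j
  proof -
    have "(\<Prod>i=1..m. a i j / S i) powr (1 / m) \<le> (\<Sum>i=1..m. a i j / S i / m)"
      using arith_geom_mean[of "{1..m}" "\<lambda>i. a i j / S i"] m a S by (auto simp: less_imp_le)
    also have "(\<Prod>i=1..m. a i j / S i) powr (1 / m) = (\<Prod>i=1..m. a i j) powr (1 / m) / (\<Prod>i=1..m. S i) powr (1 / m)"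
      using PS a by (simp add: prod_dividef powr_divide prod_nonneg)
    finally show ?thesis using PS by (simp only: pos_divide_le_eq powr_gt_zero mult.commute)
  qed
  then have "(\<Sum>j\<in>J. (\<Prod>i=1..m. a i j) powr (1 / m)) \<le>
      (\<Sum>j\<in>J. (\<Prod>i=1..m. S i) powr (1 / m) * (\<Sum>i=1..m. a i j / S i / m))"
    by (intro sum_mono)
  also have "\<dots> = (\<Prod>i=1..m. S i) powr (1 / m) * (\<Sum>i=1..m. \<Sum>j\<in>J. a i j / S i / m)"
    unfolding sum_distrib_left[symmetric] by (subst sum.swap) simp
  also have "(\<Sum>i=1..m. \<Sum>j\<in>J. a i j / S i / m) = (\<Sum>i=1..m. 1 / m)"
  proof (intro sum.cong refl)
    fix i assume "i \<in> {1..m}"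
    then show "(\<Sum>j\<in>J. a i j / S i / m) = 1 / m"
      using S[of i] by (simp add: sum_divide_distrib[symmetric] S_def[symmetric])
  qed
  also have "\<dots> = 1" using m by simp
  finally show ?thesis by (simp add: S_def)
qed

lemma ennreal_powr_le:
  assumes "t \<le> ennreal b" "0 \<le> b" "0 < a"
  shows "ennreal_powr t a \<le> ennreal (b powr a)"
proof -
  have "t \<noteq> \<infinity>" using assms(1) by (auto simp: top_unique)
  moreover have "enn2real t \<le> b" using assms(1,2) enn2real_leI by blast
  ultimately show ?thesis using assms
    by (simp add: ennreal_powr_def powr_mono2 ennreal_leI)
qed

section \<open>The A_p condition as a comparison of measures\<close>

text \<open>With \<tau> the mass of the dual weight \<sigma> = \<mu>^(1-p') on Q, one has |E|^p
  \<le> 2^p \<tau>^(p-1) M(E). Multiplying by M(Q)/|Q|^p produces on the right the A_p quotient of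
  Q, which is at most \<open>k\<close>.\<close>

lemma Muckenhoupt_A_compare:
  fixes \<mu> :: "real^'n \<Rightarrow> real"
  assumes p: "1 < p" and \<mu>: "Muckenhoupt_A p \<mu>"
  shows "\<exists>B. \<forall>Q\<in>cubes. \<forall>E\<in>sets lebesgue. E \<subseteq> Q \<longrightarrow>
    (measure lebesgue E / measure lebesgue Q) powr p * measure (density lebesgue \<mu>) Q
      \<le> B * measure (density lebesgue \<mu>) E"
proof -
  define M where "M = density lebesgue (\<lambda>x. ennreal (\<mu> x))"
  define q where "q = - 1 / (p - 1)"
  have w: "weight \<mu>" using \<mu> by (simp add: Muckenhoupt_A_def)
  have meas[measurable]: "\<mu> \<in> borel_measurable lebesgue" by (rule weight_measurable[OF w])
  have pos: "AE x in lebesgue. 0 < \<mu> x" using w by (simp add: weight_def)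
  interpret M: bounded_finite_measure M
    unfolding M_def using weight_cube_finite[OF w] by (intro bounded_finite_measure_density) auto
  define \<sigma> where "\<sigma> x = ennreal (\<mu> x powr q)" for x
  have \<sigma>_meas[measurable]: "\<sigma> \<in> borel_measurable lebesgue" unfolding \<sigma>_def by measurable
  define K where "K = (SUP Q\<in>cubes. avg Q (\<lambda>x. ennreal (\<mu> x)) * ennreal_powr (avg Q \<sigma>) (p - 1))"
  have "K < \<infinity>" unfolding K_def \<sigma>_def q_def using \<mu> by (simp only: Muckenhoupt_A_def)
  then obtain k where k: "K = ennreal k" "0 \<le> k" by (cases K) auto
  show ?thesis
  \<comment> \<open>One factor 2 comes from retaining only half of \<open>e\<close>, the remaining
    \<open>2 powr (p - 1)\<close> from the definition of \<open>c\<close>.\<close>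
  proof (intro exI[of _ "2 powr p * k"] ballI impI)
    fix Q E :: "(real^'n) set" assume Q: "Q \<in> cubes" and E: "E \<in> sets lebesgue" "E \<subseteq> Q"
    have lQ: "0 < measure lebesgue Q" by (rule measure_cube_pos[OF Q])
    have eQ: "0 < emeasure lebesgue Q" using lQ emeasure_cube[OF Q] by simp
    have bE: "bounded E" using bounded_subset[OF bounded_cubes[OF Q] E(2)] .
    have MQ: "emeasure M Q = ennreal (measure M Q)"
      using Q by (intro emeasure_eq_measure2 M.fmeasurable_bounded bounded_cubes) auto
    have "0 < emeasure M Q"
      unfolding M_def using pos Q eQ by (intro density_pos) auto
    then have MQpos: "0 < measure M Q" using MQ by simp
    define t where "t = (\<integral>\<^sup>+x\<in>Q. \<sigma> x \<partial>lebesgue)"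
    have avg_\<mu>: "avg Q (\<lambda>x. ennreal (\<mu> x)) = ennreal (measure M Q / measure lebesgue Q)"
      using MQ Q lQ emeasure_cube[OF Q]
      by (simp add: avg_def M_def emeasure_density divide_ennreal)
    have le: "ennreal (measure M Q / measure lebesgue Q) * ennreal_powr (avg Q \<sigma>) (p - 1) \<le> ennreal k"
      unfolding avg_\<mu>[symmetric] k(1)[symmetric] K_def using Q by (intro SUP_upper)
    have "t \<noteq> \<infinity>"
    proof
      assume "t = \<infinity>"
      then have "avg Q \<sigma> = \<infinity>"
        using emeasure_cube[OF Q] by (simp add: avg_def t_def ennreal_top_divide)
      then show False using le MQpos lQ by (simp add: ennreal_powr_def ennreal_mult_top top_unique)
    qed
    then obtain \<tau> where \<tau>: "t = ennreal \<tau>" "0 \<le> \<tau>" by (cases t) auto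
    have "0 < emeasure (density lebesgue \<sigma>) Q"
    proof (rule density_pos)
      show "AE x in lebesgue. 0 < \<sigma> x" using pos by eventually_elim (simp add: \<sigma>_def)
    qed (use Q eQ in auto)
    then have \<tau>pos: "0 < \<tau>" using Q \<tau> by (simp add: emeasure_density t_def)
    have "avg Q \<sigma> = ennreal (\<tau> / measure lebesgue Q)"
      using \<tau> lQ emeasure_cube[OF Q] by (simp add: avg_def t_def divide_ennreal)
    then have "ennreal_powr (avg Q \<sigma>) (p - 1) = ennreal ((\<tau> / measure lebesgue Q) powr (p - 1))"
      using \<tau> by (simp add: ennreal_powr_def)
    with le have kQ: "measure M Q / measure lebesgue Q * (\<tau> / measure lebesgue Q) powr (p - 1) \<le> k"
      using k by (simp add: ennreal_mult[symmetric])
    have "(measure lebesgue E / measure lebesgue Q) powr p * measure M Q \<le> (2 powr p * k) * measure M E"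
    proof (cases "measure lebesgue E = 0")
      case True
      then show ?thesis using p k by simp
    next
      case False
      define e where "e = measure lebesgue E"
      have e: "0 < e" using False by (simp add: e_def less_le)
      define c where "c = (2 * \<tau> / e) powr (p - 1)"
      have c: "0 < c" using e \<tau>pos by (simp add: c_def)
      have cq: "c powr q = e / (2 * \<tau>)"
        using p e \<tau>pos by (simp add: c_def q_def powr_powr powr_minus_divide)
      have ae: "AE x in lebesgue. 1 * indicator E x \<le>
          ennreal c * (ennreal (\<mu> x) * indicator E x) + ennreal (c powr q) * (\<sigma> x * indicator Q x)"
        using pos
      proof eventually_elim
        case (elim x)
        \<comment> \<open>Replaces the Hoelder inequality; \<open>c\<close> is chosen so that the second term integrates to half of \<open>e\<close>.\<close>
        have "1 \<le> c * \<mu> x + c powr q * \<mu> x powr q"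
        proof (cases "1 \<le> c * \<mu> x")
          case True
          moreover have "0 \<le> c powr q * \<mu> x powr q" by simp
          ultimately show ?thesis by linarith
        next
          case False
          have "0 < c * \<mu> x" using c elim by simp
          moreover have "q < 0" using p by (simp add: q_def)
          ultimately have "1 powr q \<le> (c * \<mu> x) powr q"
            using False by (intro powr_mono2') auto
          then have "1 \<le> c powr q * \<mu> x powr q"
            using c elim by (simp add: powr_mult)
          then show ?thesis using \<open>0 < c * \<mu> x\<close> by linarith
        qed
        then have "ennreal 1 \<le> ennreal (c * \<mu> x + c powr q * \<mu> x powr q)" by (rule ennreal_leI)
        also have "\<dots> = ennreal c * ennreal (\<mu> x) + ennreal (c powr q) * \<sigma> x"
          using c elim by (simp add: \<sigma>_def ennreal_mult ennreal_plus)
        finally show ?case using E(2) by (auto simp: indicator_def)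
      qed
      have "emeasure lebesgue E = (\<integral>\<^sup>+x. 1 * indicator E x \<partial>lebesgue)" using E by simp
      also have "\<dots> \<le> (\<integral>\<^sup>+x. ennreal c * (ennreal (\<mu> x) * indicator E x) +
          ennreal (c powr q) * (\<sigma> x * indicator Q x) \<partial>lebesgue)"
        by (rule nn_integral_mono_AE[OF ae])
      also have "\<dots> = ennreal c * emeasure M E + ennreal (c powr q) * t"
      proof -
        have [measurable]: "E \<in> sets lebesgue" "Q \<in> sets lebesgue" using E Q by auto
        have "emeasure M E = (\<integral>\<^sup>+x\<in>E. ennreal (\<mu> x) \<partial>lebesgue)"
          using E unfolding M_def by (intro emeasure_density) auto
        then show ?thesis unfolding t_def
          by (subst nn_integral_add; (subst nn_integral_cmult)?; (subst nn_integral_cmult)?; simp)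
      qed
      also have "\<dots> = ennreal (c * measure M E + c powr q * \<tau>)"
        using emeasure_eq_measure2[OF M.fmeasurable_bounded[OF E(1) bE]] \<tau> c
        by (simp add: ennreal_mult ennreal_plus)
      finally have "ennreal e \<le> ennreal (c * measure M E + c powr q * \<tau>)"
        using emeasure_eq_measure2[OF lebesgue.fmeasurable_bounded[OF E(1) bE]] by (simp only: e_def)
      then have "e \<le> c * measure M E + c powr q * \<tau>"
        using c \<tau> by (subst (asm) ennreal_le_iff) auto
      then have "e / 2 \<le> c * measure M E" using \<tau>pos by (simp add: cq)
      moreover have pp: "y powr p = y * y powr (p - 1)" if "0 < y" for y :: real
        using that powr_add[of y 1 "p - 1"] by simp
      have "e powr p = e / 2 * (2 * e powr (p - 1))" using pp[OF e] by simp
      also have "\<dots> \<le> c * measure M E * (2 * e powr (p - 1))"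
        using \<open>e / 2 \<le> c * measure M E\<close> by (intro mult_right_mono) auto
      also have "\<dots> = 2 powr p * \<tau> powr (p - 1) * measure M E"
        using e \<tau>pos pp[of 2] by (simp add: c_def powr_mult powr_divide)
      finally have "e powr p * (measure M Q / measure lebesgue Q powr p) \<le>
          2 powr p * \<tau> powr (p - 1) * measure M E * (measure M Q / measure lebesgue Q powr p)"
        by (intro mult_right_mono) auto
      also have "\<dots> = 2 powr p * (measure M Q / measure lebesgue Q * (\<tau> / measure lebesgue Q) powr (p - 1)) * measure M E"
        using lQ \<tau>pos pp[OF lQ] by (simp add: powr_divide)
      also have "\<dots> \<le> 2 powr p * k * measure M E"
        using kQ by (intro mult_right_mono mult_left_mono) auto
      also have "e powr p * (measure M Q / measure lebesgue Q powr p) =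
          (measure lebesgue E / measure lebesgue Q) powr p * measure M Q"
        using e lQ by (simp add: e_def powr_divide)
      finally show ?thesis .
    qed
    then show "(measure lebesgue E / measure lebesgue Q) powr p * measure (density lebesgue \<mu>) Q
      \<le> 2 powr p * k * measure (density lebesgue \<mu>) E" by (simp add: M_def)
  qed
qed

section \<open>Geometric means and the multilinear A_1 condition\<close>

lemma geom_mean_nonneg: "0 \<le> geom_mean m w x"
  by (simp add: geom_mean_def prod_nonneg)

lemma geom_mean_eq: "(\<And>i. i \<in> {1..m} \<Longrightarrow> 0 \<le> w i x) \<Longrightarrow> geom_mean m w x = (\<Prod>i=1..m. w i x) powr (1 / m)"
  unfolding geom_mean_def by (subst prod_powr_distrib) auto

lemma geom_mean_measurable:
  fixes w :: "nat \<Rightarrow> real^'n \<Rightarrow> real"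
  assumes "\<And>i. i \<in> {1..m} \<Longrightarrow> weight (w i)"
  shows "geom_mean m w \<in> borel_measurable lebesgue"
  unfolding geom_mean_def[abs_def]
proof (rule borel_measurable_prod)
  fix i assume "i \<in> {1..m}"
  then have [measurable]: "w i \<in> borel_measurable lebesgue" by (intro weight_measurable assms)
  show "(\<lambda>x. w i x powr (1 / real m)) \<in> borel_measurable lebesgue" by measurable
qed

lemma AE_weights_pos:
  fixes w :: "nat \<Rightarrow> real^'n \<Rightarrow> real"
  assumes "\<And>i. i \<in> {1..m} \<Longrightarrow> weight (w i)"
  shows "AE x in lebesgue. \<forall>i\<in>{1..m}. 0 < w i x"
  using assms by (intro AE_finite_allI) (auto simp: weight_def)

lemma geom_mean_pos:
  assumes "\<forall>i\<in>{1..m}. 0 < w i x"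
  shows "0 < geom_mean m w x"
  unfolding geom_mean_def
proof (rule prod_pos)
  fix i assume "i \<in> {1..m}"
  then have "0 < w i x" using assms by blast
  then show "0 < w i x powr (1 / real m)" by simp
qed

text \<open>Converts the extended-valued supremum into real constants, with \<open>d i\<close> the
  essential infima. The average of \<nu> is positive and no essential infimum is infinite, so
  finiteness of the product forces every infimum to be positive and, for m > 0, the average to be
  finite.\<close>

lemma multilinear_A1_cube:
  fixes w :: "nat \<Rightarrow> real^'n \<Rightarrow> real"
  assumes A1: "multilinear_A1 m w"
  defines "N \<equiv> density lebesgue (\<lambda>x. ennreal (geom_mean m w x))"
  shows "\<exists>k>0. \<forall>Q\<in>cubes. 0 < emeasure N Q \<and> emeasure N Q < \<infinity> \<and>
    (\<exists>d. (\<forall>i\<in>{1..m}. 0 < d i \<and> (AE x in lebesgue. x \<in> Q \<longrightarrow> d i \<le> w i x)) \<and>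
      (measure N Q / measure lebesgue Q) ^ m \<le> k * (\<Prod>i=1..m. d i))"
proof -
  have wt: "\<And>i. i \<in> {1..m} \<Longrightarrow> weight (w i)" using A1 by (simp add: multilinear_A1_def)
  note meas = geom_mean_measurable[OF wt]
  define c where "c Q i = ess_inf_on Q (\<lambda>x. ennreal (w i x))" for Q i
  define K where "K = (SUP Q\<in>cubes. avg Q (\<lambda>x. ennreal (geom_mean m w x)) ^ m * (\<Prod>i=1..m. inverse (c Q i)))"
  have "K < \<infinity>" using A1 unfolding multilinear_A1_def K_def c_def by simp
  then obtain k where k: "K = ennreal k" "0 \<le> k" by (cases K) auto
  show ?thesis
  \<comment> \<open>The supremum is only known to be nonnegative; adding 1 makes the constant
    positive.\<close>
  proof (intro exI[of _ "k + 1"] conjI ballI)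
    show "0 < k + 1" using k by simp
    fix Q :: "(real^'n) set" assume Q: "Q \<in> cubes"
    have lQ: "0 < measure lebesgue Q" by (rule measure_cube_pos[OF Q])
    have eQ: "0 < emeasure lebesgue Q" using lQ emeasure_cube[OF Q] by simp
    have pos: "AE x in lebesgue. 0 < ennreal (geom_mean m w x)"
    proof -
      have "AE x in lebesgue. \<forall>i\<in>{1..m}. 0 < w i x" by (rule AE_weights_pos[OF wt])
      then show ?thesis by eventually_elim (simp add: geom_mean_pos)
    qed
    have Npos: "0 < emeasure N Q"
      unfolding N_def using meas Q eQ by (intro density_pos[OF _ pos]) auto
    have avgN: "avg Q (\<lambda>x. ennreal (geom_mean m w x)) = emeasure N Q / emeasure lebesgue Q"
      using meas Q by (simp add: avg_def N_def emeasure_density)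
    have c_ae: "AE x in lebesgue. x \<in> Q \<longrightarrow> c Q i \<le> ennreal (w i x)" for i
      unfolding c_def by (rule AE_ess_inf_on)
    have c_fin: "c Q i \<noteq> \<infinity>" for i
    proof
      assume "c Q i = \<infinity>"
      with c_ae[of i] have "AE x in lebesgue. x \<notin> Q" by (auto simp: top_unique elim: eventually_mono)
      then have "emeasure lebesgue Q = 0" using Q AE_iff_null_sets[of Q lebesgue] by auto
      with eQ show False by simp
    qed
    have le: "(emeasure N Q / emeasure lebesgue Q) ^ m * (\<Prod>i=1..m. inverse (c Q i)) \<le> ennreal k"
      unfolding avgN[symmetric] k(1)[symmetric] K_def using Q by (intro SUP_upper)
    have inv_pos: "inverse (c Q i) \<noteq> 0" for i
      using c_fin[of i] by simp
    have avg_pos: "emeasure N Q / emeasure lebesgue Q \<noteq> 0"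
      using Npos emeasure_cube[OF Q] lQ by (simp add: ennreal_divide_eq_0_iff)
    have c_pos: "c Q i \<noteq> 0" if i: "i \<in> {1..m}" for i
    proof
      assume "c Q i = 0"
      then have "(\<Prod>i=1..m. inverse (c Q i)) = \<infinity>"
        using i inv_pos by (subst prod.remove[of _ i]) (auto simp: ennreal_top_mult)
      then have "(emeasure N Q / emeasure lebesgue Q) ^ m * (\<Prod>i=1..m. inverse (c Q i)) = \<infinity>"
        using avg_pos by (simp add: ennreal_mult_top)
      with le show False by (simp add: top_unique)
    qed
    have Nfin: "emeasure N Q < \<infinity>"
    \<comment> \<open>For m = 0 the m-th power carries no information on the average, but the empty
      geometric mean is the constant 1.\<close>
    proof (cases "m = 0")
      case True
      then have "geom_mean m w = (\<lambda>_. 1)" by (auto simp: geom_mean_def)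
      then show ?thesis using Q emeasure_cube[OF Q] by (simp add: N_def emeasure_density)
    next
      case False
      show ?thesis
      proof (rule ccontr)
        assume "\<not> emeasure N Q < \<infinity>"
        then have "emeasure N Q = \<infinity>" by (simp add: less_top[symmetric])
        then have "emeasure N Q / emeasure lebesgue Q = \<infinity>"
          using emeasure_cube[OF Q] by (simp add: ennreal_top_divide)
        then have "(emeasure N Q / emeasure lebesgue Q) ^ m * (\<Prod>i=1..m. inverse (c Q i)) = \<infinity>"
          using inv_pos False by (simp add: ennreal_top_mult power_eq_top_ennreal)
        with le show False by (simp add: top_unique)
      qed
    qed
    then have NQ: "emeasure N Q = ennreal (measure N Q)" by (simp add: emeasure_eq_ennreal_measure)
    define d where "d i = enn2real (c Q i)" for i
    have cd: "c Q i = ennreal (d i)" for i using c_fin by (simp add: d_def less_top)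
    have d: "0 < d i" if "i \<in> {1..m}" for i
      using c_pos[OF that] c_fin[of i] by (simp add: d_def enn2real_positive_iff less_top zero_less_iff_neq_zero)
    have "(\<Prod>i=1..m. inverse (c Q i)) = (\<Prod>i=1..m. ennreal (inverse (d i)))"
      using d by (intro prod.cong) (auto simp: cd inverse_ennreal)
    also have "\<dots> = ennreal (\<Prod>i=1..m. inverse (d i))"
      using d by (intro prod_ennreal) (simp add: less_imp_le)
    finally have inv_eq: "(\<Prod>i=1..m. inverse (c Q i)) = ennreal (\<Prod>i=1..m. inverse (d i))" .
    have d_inv: "0 \<le> (\<Prod>i=1..m. inverse (d i))"
      using d by (intro prod_nonneg) (simp add: less_imp_le)
    have "ennreal ((measure N Q / measure lebesgue Q) ^ m * (\<Prod>i=1..m. inverse (d i))) \<le> ennreal k"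
      using le emeasure_cube[OF Q] lQ d_inv unfolding inv_eq NQ
      by (simp add: divide_ennreal ennreal_power ennreal_mult)
    then have "(measure N Q / measure lebesgue Q) ^ m * (\<Prod>i=1..m. inverse (d i)) \<le> k"
      using k by simp
    moreover have dp: "0 < (\<Prod>i=1..m. d i)" using d by (intro prod_pos) auto
    ultimately have "(measure N Q / measure lebesgue Q) ^ m \<le> k * (\<Prod>i=1..m. d i)"
      using prod_inversef[of d "{1..m}"]
      by (simp only: comp_def divide_inverse[symmetric] pos_divide_le_eq)
    also have "\<dots> \<le> (k + 1) * (\<Prod>i=1..m. d i)" using dp by simp
    finally have "(measure N Q / measure lebesgue Q) ^ m \<le> (k + 1) * (\<Prod>i=1..m. d i)" .
    moreover have "AE x in lebesgue. x \<in> Q \<longrightarrow> d i \<le> w i x" if "i \<in> {1..m}" for i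
      using c_ae[of i] by eventually_elim (use wt[OF that] in \<open>auto simp: cd weight_def\<close>)
    ultimately show "\<exists>d. (\<forall>i\<in>{1..m}. 0 < d i \<and> (AE x in lebesgue. x \<in> Q \<longrightarrow> d i \<le> w i x)) \<and>
      (measure N Q / measure lebesgue Q) ^ m \<le> (k + 1) * (\<Prod>i=1..m. d i)"
      using d by blast
    show "0 < emeasure N Q" "emeasure N Q < \<infinity>" by fact+
  qed
qed

section \<open>The mixed weak-type inequality\<close>

lemma power_powr_inverse:
  fixes x :: real
  assumes "0 \<le> x" "1 \<le> m"
  shows "(x ^ m) powr (1 / real m) = x" "(x powr (1 / real m)) ^ m = x"
    "x powr (1 / (1 / real m)) = x ^ m"
  using assms by (cases "x = 0"; simp add: powr_realpow[symmetric] powr_powr)+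

text \<open>The multilinear condition makes \<nu> an A_1 weight: with \<open>D\<close> the geometric
  mean of the lower bounds \<open>d i\<close>, \<nu> \<ge> D almost everywhere on Q gives N(E) \<ge>
  D |E|, while the m-th root of the condition gives N(Q)/|Q| \<le> k^(1/m) D. Hence the A_1 constant
  is \<open>k powr (1 / m)\<close>.\<close>

lemma multilinear_A1_muckenhoupt_pair:
  fixes m :: nat and w :: "nat \<Rightarrow> real^'n \<Rightarrow> real" and v :: "real^'n \<Rightarrow> real"
  defines "\<nu> \<equiv> geom_mean m w"
  defines "V \<equiv> \<lambda>x. v x powr (1 / real m)"
  assumes m: "1 \<le> m" and A1: "multilinear_A1 m w" and v: "weight v"
    and Ainf: "Muckenhoupt_A_infinity (\<lambda>x. \<nu> x * V x)"
  obtains A B p where "muckenhoupt_pair (density lebesgue (\<lambda>x. ennreal (\<nu> x)))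
    (density lebesgue (\<lambda>x. ennreal (\<nu> x * V x))) V A B p"
proof -
  define N where "N = density lebesgue (\<lambda>x. ennreal (\<nu> x))"
  define M where "M = density lebesgue (\<lambda>x. ennreal (\<nu> x * V x))"
  have wt: "\<And>i. i \<in> {1..m} \<Longrightarrow> weight (w i)" using A1 by (simp add: multilinear_A1_def)
  obtain p where p: "1 < p" "Muckenhoupt_A p (\<lambda>x. \<nu> x * V x)"
    using Ainf by (auto simp: Muckenhoupt_A_infinity_def)
  then have wM: "weight (\<lambda>x. \<nu> x * V x)" by (simp add: Muckenhoupt_A_def)
  have [measurable]: "\<nu> \<in> borel_measurable lebesgue"
    unfolding \<nu>_def by (rule geom_mean_measurable[OF wt])
  have [measurable]: "v \<in> borel_measurable lebesgue" by (rule weight_measurable[OF v])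
  have V_meas[measurable]: "V \<in> borel_measurable lebesgue" unfolding V_def by measurable
  have \<nu>0: "0 \<le> \<nu> x" for x by (simp add: \<nu>_def geom_mean_nonneg)
  obtain k where k: "0 < k" and cubes_all: "\<forall>Q\<in>cubes. 0 < emeasure N Q \<and> emeasure N Q < \<infinity> \<and>
    (\<exists>d. (\<forall>i\<in>{1..m}. 0 < d i \<and> (AE x in lebesgue. x \<in> Q \<longrightarrow> d i \<le> w i x)) \<and>
      (measure N Q / measure lebesgue Q) ^ m \<le> k * (\<Prod>i=1..m. d i))"
    using multilinear_A1_cube[OF A1] unfolding N_def \<nu>_def by blast
  have cube: "0 < emeasure N Q \<and> emeasure N Q < \<infinity> \<and>
    (\<exists>d. (\<forall>i\<in>{1..m}. 0 < d i \<and> (AE x in lebesgue. x \<in> Q \<longrightarrow> d i \<le> w i x)) \<and>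
      (measure N Q / measure lebesgue Q) ^ m \<le> k * (\<Prod>i=1..m. d i))" if "Q \<in> cubes" for Q
    by (rule bspec[OF cubes_all that])
  obtain B where B: "\<forall>Q\<in>cubes. \<forall>E\<in>sets lebesgue. E \<subseteq> Q \<longrightarrow>
    (measure lebesgue E / measure lebesgue Q) powr p * measure M Q \<le> B * measure M E"
    using Muckenhoupt_A_compare[OF p] unfolding M_def by blast
  interpret N: bounded_finite_measure N
    unfolding N_def
  proof (rule bounded_finite_measure_density)
    fix Q :: "(real^'n) set" assume "Q \<in> cubes"
    then show "(\<integral>\<^sup>+x\<in>Q. ennreal (\<nu> x) \<partial>lebesgue) < \<infinity>"
      using cube[of Q] unfolding N_def by (simp add: emeasure_density)
  qed measurable
  interpret M: bounded_finite_measure M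
    unfolding M_def by (rule bounded_finite_measure_density[OF _ weight_cube_finite[OF wM]]) measurable
  have "muckenhoupt_pair N M V (k powr (1 / m)) B p"
  proof
    show "0 < p" using p by simp
    show "0 \<le> V x" for x by (simp add: V_def)
    show "V \<in> borel_measurable lebesgue" by (rule V_meas)
    show "0 < measure N Q" if "Q \<in> cubes" for Q
      using cube[OF that] by (simp add: measure_def enn2real_positive_iff)
    show "0 < measure M Q" if Q: "Q \<in> cubes" for Q
    proof -
      have "0 < emeasure M Q"
        unfolding M_def
      proof (rule density_pos)
        have "AE x in lebesgue. 0 < \<nu> x * V x" using wM by (simp add: weight_def)
        then show "AE x in lebesgue. 0 < ennreal (\<nu> x * V x)" by eventually_elim simp
        show "0 < emeasure lebesgue Q" using measure_cube_pos[OF Q] emeasure_cube[OF Q] by simp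
      qed (use Q in auto)
      then show ?thesis
        using emeasure_eq_measure2[OF M.fmeasurable_bounded[OF sets_cubes[OF Q] bounded_cubes[OF Q]]] by simp
    qed
    show "(measure lebesgue E / measure lebesgue Q) powr p * measure M Q \<le> B * measure M E"
      if "Q \<in> cubes" "E \<in> sets lebesgue" "E \<subseteq> Q" for Q E
      using B that by blast
  next
    fix Q E :: "(real^'n) set"
    assume Q: "Q \<in> cubes" and E: "E \<in> sets lebesgue" "E \<subseteq> Q"
    have lQ: "0 < measure lebesgue Q" by (rule measure_cube_pos[OF Q])
    have bE: "bounded E" using bounded_subset[OF bounded_cubes[OF Q] E(2)] .
    obtain d where d: "\<forall>i\<in>{1..m}. 0 < d i \<and> (AE x in lebesgue. x \<in> Q \<longrightarrow> d i \<le> w i x)"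
      "(measure N Q / measure lebesgue Q) ^ m \<le> k * (\<Prod>i=1..m. d i)"
      using cube[OF Q] by blast
    define D where "D = (\<Prod>i=1..m. d i) powr (1 / m)"
    have D0: "0 \<le> D" by (simp add: D_def)
    have "AE x in lebesgue. \<forall>i\<in>{1..m}. x \<in> Q \<longrightarrow> d i \<le> w i x"
      using d(1) by (intro AE_finite_allI) auto
    then have ae: "AE x in lebesgue. ennreal D * indicator E x \<le> ennreal (\<nu> x) * indicator E x"
    proof eventually_elim
      case (elim x)
      show ?case
      proof (cases "x \<in> E")
        case True
        with elim E have le: "\<forall>i\<in>{1..m}. d i \<le> w i x" by blast
        have "(\<Prod>i=1..m. d i) \<le> (\<Prod>i=1..m. w i x)"
          using le d(1) by (intro prod_mono) (auto simp: less_imp_le)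
        moreover have "\<nu> x = (\<Prod>i=1..m. w i x) powr (1 / m)"
          unfolding \<nu>_def using wt by (intro geom_mean_eq) (auto simp: weight_def)
        moreover have "0 \<le> (\<Prod>i=1..m. d i)" using d(1) by (intro prod_nonneg) (simp add: less_imp_le)
        ultimately have "D \<le> \<nu> x" unfolding D_def by (simp add: powr_mono2)
        then show ?thesis using True by (simp add: ennreal_leI)
      qed simp
    qed
    have "ennreal (D * measure lebesgue E) = (\<integral>\<^sup>+x. ennreal D * indicator E x \<partial>lebesgue)"
      using E emeasure_eq_measure2[OF lebesgue.fmeasurable_bounded[OF E(1) bE]] D0
      by (simp add: nn_integral_cmult_indicator ennreal_mult)
    also have "\<dots> \<le> (\<integral>\<^sup>+x. ennreal (\<nu> x) * indicator E x \<partial>lebesgue)"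
      by (rule nn_integral_mono_AE[OF ae])
    also have "\<dots> = ennreal (measure N E)"
      using emeasure_eq_measure2[OF N.fmeasurable_bounded[OF E(1) bE]] E by (simp add: N_def emeasure_density)
    finally have DE: "D * measure lebesgue E \<le> measure N E" by simp
    have "measure N Q / measure lebesgue Q = ((measure N Q / measure lebesgue Q) ^ m) powr (1 / m)"
      using m by (simp add: power_powr_inverse)
    also have "\<dots> \<le> (k * (\<Prod>i=1..m. d i)) powr (1 / m)"
      using d(2) by (intro powr_mono2) auto
    also have "\<dots> = k powr (1 / m) * D"
      using k d(1) by (simp add: powr_mult D_def prod_nonneg less_imp_le)
    finally have "measure N Q \<le> k powr (1 / m) * D * measure lebesgue Q"
      using lQ by (simp add: pos_divide_le_eq)
    then have "measure lebesgue E * measure N Q \<le> measure lebesgue E * (k powr (1 / m) * D * measure lebesgue Q)"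
      by (intro mult_left_mono) auto
    also have "\<dots> = k powr (1 / m) * (D * measure lebesgue E) * measure lebesgue Q" by simp
    also have "\<dots> \<le> k powr (1 / m) * measure N E * measure lebesgue Q"
      using DE by (intro mult_right_mono mult_left_mono) auto
    finally show "measure lebesgue E * measure N Q \<le> k powr (1 / m) * measure N E * measure lebesgue Q" .
  next
    fix E :: "(real^'n) set" and c
    assume E: "E \<in> sets lebesgue" "bounded E" and c: "\<And>x. x \<in> E \<Longrightarrow> V x < c" "0 < c"
    have "emeasure M E = (\<integral>\<^sup>+x\<in>E. ennreal (\<nu> x * V x) \<partial>lebesgue)"
      using E unfolding M_def by (intro emeasure_density) auto
    also have "\<dots> \<le> (\<integral>\<^sup>+x. ennreal c * (ennreal (\<nu> x) * indicator E x) \<partial>lebesgue)"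
    proof (intro nn_integral_mono)
      fix x
      show "ennreal (\<nu> x * V x) * indicator E x \<le> ennreal c * (ennreal (\<nu> x) * indicator E x)"
      proof (cases "x \<in> E")
        case True
        then have "\<nu> x * V x \<le> c * \<nu> x"
          using mult_left_mono[OF less_imp_le[OF c(1)] \<nu>0] by (simp add: mult.commute)
        then show ?thesis using True c(2) \<nu>0 by (simp add: ennreal_mult[symmetric] ennreal_leI)
      qed simp
    qed
    also have "\<dots> = ennreal c * emeasure N E"
      using E by (simp add: nn_integral_cmult N_def emeasure_density)
    finally have "emeasure M E \<le> ennreal c * emeasure N E" .
    then show "measure M E \<le> c * measure N E"
      using emeasure_eq_measure2[OF N.fmeasurable_bounded[OF E]] emeasure_eq_measure2[OF M.fmeasurable_bounded[OF E]] c(2)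
      by (simp add: ennreal_mult[symmetric])
  qed
  then show ?thesis using that unfolding N_def M_def by blast
qed

lemma prod_mono_ennreal:
  fixes f g :: "'a \<Rightarrow> ennreal"
  shows "(\<And>i. i \<in> A \<Longrightarrow> f i \<le> g i) \<Longrightarrow> prod f A \<le> prod g A"
  by (induction A rule: infinite_finite_induct) (auto intro: mult_mono)

text \<open>Since w_i \<ge> d_i almost everywhere on Q, the average of |f_i| is at most F_i(Q) /
  (d_i |Q|), with F_i the measure |f_i| w_i dx. The multilinear condition then trades the product of
  the d_i for N(Q)^m. The constant is chosen before \<open>f\<close>.\<close>

lemma multilinear_A1_prod_avg_le:
  fixes m :: nat and w :: "nat \<Rightarrow> real^'n \<Rightarrow> real"
  assumes A1: "multilinear_A1 m w"
  defines "N \<equiv> density lebesgue (\<lambda>x. ennreal (geom_mean m w x))"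
  shows "\<exists>k>0. \<forall>Q\<in>cubes. \<forall>f :: nat \<Rightarrow> real^'n \<Rightarrow> 'b::real_normed_vector.
    (\<forall>i\<in>{1..m}. f i \<in> L1_space (w i)) \<longrightarrow>
    (\<Prod>i=1..m. avg Q (\<lambda>y. ennreal (norm (f i y)))) \<le>
      ennreal (k * (\<Prod>i=1..m. measure (density lebesgue (\<lambda>x. ennreal (norm (f i x) * w i x))) Q) / measure N Q ^ m)"
proof -
  have wt: "\<And>i. i \<in> {1..m} \<Longrightarrow> weight (w i)" using A1 by (simp add: multilinear_A1_def)
  obtain k where k: "0 < k" and cubes_all: "\<forall>Q\<in>cubes. 0 < emeasure N Q \<and> emeasure N Q < \<infinity> \<and>
    (\<exists>d. (\<forall>i\<in>{1..m}. 0 < d i \<and> (AE x in lebesgue. x \<in> Q \<longrightarrow> d i \<le> w i x)) \<and>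
      (measure N Q / measure lebesgue Q) ^ m \<le> k * (\<Prod>i=1..m. d i))"
    using multilinear_A1_cube[OF A1] unfolding N_def by blast
  have cube: "0 < emeasure N Q \<and> emeasure N Q < \<infinity> \<and>
    (\<exists>d. (\<forall>i\<in>{1..m}. 0 < d i \<and> (AE x in lebesgue. x \<in> Q \<longrightarrow> d i \<le> w i x)) \<and>
      (measure N Q / measure lebesgue Q) ^ m \<le> k * (\<Prod>i=1..m. d i))" if "Q \<in> cubes" for Q
    by (rule bspec[OF cubes_all that])
  show ?thesis
  proof (intro exI[of _ k] conjI ballI allI impI k)
    fix Q :: "(real^'n) set" and f :: "nat \<Rightarrow> real^'n \<Rightarrow> 'b"
    assume Q: "Q \<in> cubes" and f: "\<forall>i\<in>{1..m}. f i \<in> L1_space (w i)"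
    define F where "F i = density lebesgue (\<lambda>x. ennreal (norm (f i x) * w i x))" for i
    have lQ: "0 < measure lebesgue Q" by (rule measure_cube_pos[OF Q])
    have NQ: "0 < measure N Q" using cube[OF Q] by (simp add: measure_def enn2real_positive_iff)
    obtain d where d: "\<And>i. i \<in> {1..m} \<Longrightarrow> 0 < d i" "\<And>i. i \<in> {1..m} \<Longrightarrow> AE x in lebesgue. x \<in> Q \<longrightarrow> d i \<le> w i x"
      "(measure N Q / measure lebesgue Q) ^ m \<le> k * (\<Prod>i=1..m. d i)"
      using cube[OF Q] by blast
    have avg_le: "avg Q (\<lambda>y. ennreal (norm (f i y))) \<le> ennreal (measure (F i) Q / (d i * measure lebesgue Q))"
      if i: "i \<in> {1..m}" for i
    proof -
      have [measurable]: "w i \<in> borel_measurable lebesgue" by (rule weight_measurable[OF wt[OF i]])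
      have [measurable]: "f i \<in> borel_measurable lebesgue" and L: "L1_norm (w i) (f i) < \<infinity>"
        using f i by (auto simp: L1_space_def)
      have w0: "0 \<le> w i x" for x using wt[OF i] by (simp add: weight_def)
      have FQ: "emeasure (F i) Q = (\<integral>\<^sup>+x\<in>Q. ennreal (norm (f i x) * w i x) \<partial>lebesgue)"
        using Q unfolding F_def by (intro emeasure_density) auto
      also have "\<dots> \<le> L1_norm (w i) (f i)"
        unfolding L1_norm_def by (intro nn_integral_mono) (auto simp: indicator_def)
      finally have "emeasure (F i) Q < \<infinity>" using L by (rule le_less_trans)
      then have FQ': "emeasure (F i) Q = ennreal (measure (F i) Q)"
        by (simp add: emeasure_eq_ennreal_measure)
      have "(\<integral>\<^sup>+x\<in>Q. ennreal (norm (f i x)) \<partial>lebesgue) \<le>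
          (\<integral>\<^sup>+x. ennreal (1 / d i) * (ennreal (norm (f i x) * w i x) * indicator Q x) \<partial>lebesgue)"
      proof (rule nn_integral_mono_AE)
        show "AE x in lebesgue. ennreal (norm (f i x)) * indicator Q x \<le>
            ennreal (1 / d i) * (ennreal (norm (f i x) * w i x) * indicator Q x)"
          using d(2)[OF i]
        proof eventually_elim
          case (elim x)
          show ?case
          proof (cases "x \<in> Q")
            case True
            with elim have "norm (f i x) * d i \<le> norm (f i x) * w i x" by (intro mult_left_mono) auto
            then have "norm (f i x) \<le> 1 / d i * (norm (f i x) * w i x)"
              using d(1)[OF i] by (simp add: field_simps)
            then show ?thesis using True d(1)[OF i] w0
              by (simp add: ennreal_mult[symmetric] ennreal_leI)
          qed simp
        qed
      qed
      also have "\<dots> = ennreal (1 / d i) * (\<integral>\<^sup>+x\<in>Q. ennreal (norm (f i x) * w i x) \<partial>lebesgue)"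
      proof (rule nn_integral_cmult)
        have [measurable]: "Q \<in> sets lebesgue" using Q by simp
        show "(\<lambda>x. ennreal (norm (f i x) * w i x) * indicator Q x) \<in> borel_measurable lebesgue"
          by measurable
      qed
      also have "\<dots> = ennreal (measure (F i) Q / d i)"
        unfolding FQ[symmetric] FQ' using d(1)[OF i] by (subst ennreal_mult[symmetric]) auto
      finally have "avg Q (\<lambda>y. ennreal (norm (f i y))) \<le> ennreal (measure (F i) Q / d i) / emeasure lebesgue Q"
        unfolding avg_def by (rule divide_right_mono_ennreal)
      also have "\<dots> = ennreal (measure (F i) Q / (d i * measure lebesgue Q))"
        using emeasure_cube[OF Q] lQ d(1)[OF i] by (simp add: divide_ennreal)
      finally show ?thesis .
    qed
    define P where "P = (\<Prod>i=1..m. measure (F i) Q)"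
    have P: "0 \<le> P" by (simp add: P_def prod_nonneg)
    have dp: "0 < (\<Prod>i=1..m. d i)" using d(1) by (intro prod_pos) auto
    have "(\<Prod>i=1..m. avg Q (\<lambda>y. ennreal (norm (f i y)))) \<le>
        (\<Prod>i=1..m. ennreal (measure (F i) Q / (d i * measure lebesgue Q)))"
      using avg_le by (intro prod_mono_ennreal)
    also have "\<dots> = ennreal (\<Prod>i=1..m. measure (F i) Q / (d i * measure lebesgue Q))"
      using d(1) by (intro prod_ennreal) (simp add: less_imp_le)
    also have "(\<Prod>i=1..m. measure (F i) Q / (d i * measure lebesgue Q)) =
        P / ((\<Prod>i=1..m. d i) * measure lebesgue Q ^ m)"
      by (simp add: prod_dividef prod.distrib P_def)
    also have "\<dots> \<le> k * P / measure N Q ^ m"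
    proof -
      have "measure N Q ^ m \<le> k * ((\<Prod>i=1..m. d i) * measure lebesgue Q ^ m)"
        using d(3) lQ by (simp add: power_divide pos_divide_le_eq mult.assoc)
      then have "P * measure N Q ^ m \<le> P * (k * ((\<Prod>i=1..m. d i) * measure lebesgue Q ^ m))"
        using P by (intro mult_left_mono)
      then show ?thesis using NQ dp lQ
        by (simp add: divide_le_eq pos_le_divide_eq mult_ac)
    qed
    finally show "(\<Prod>i=1..m. avg Q (\<lambda>y. ennreal (norm (f i y)))) \<le>
      ennreal (k * (\<Prod>i=1..m. measure (density lebesgue (\<lambda>x. ennreal (norm (f i x) * w i x))) Q) / measure N Q ^ m)"
      by (simp add: P_def F_def ennreal_leI)
  qed
qed

theorem theorem1p5:
  fixes m :: nat
    and w :: "nat \<Rightarrow> real^'n \<Rightarrow> real"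
    and v :: "real^'n \<Rightarrow> real"
  assumes "m \<ge> 1"
    and "multilinear_A1 m w"
    and "weight v"
    and "Muckenhoupt_A_infinity (\<lambda>x. geom_mean m w x * v x powr (1 / real m))"
  shows "\<exists>C::real. \<forall>f :: nat \<Rightarrow> real^'n \<Rightarrow> complex.
           (\<forall>i\<in>{1..m}. f i \<in> L1_space (w i)) \<longrightarrow>
           weak_norm (1 / real m) (\<lambda>x. geom_mean m w x * v x powr (1 / real m))
               (\<lambda>x. multi_maximal m f x / ennreal (v x))
             \<le> ennreal C * (\<Prod>i=1..m. L1_norm (w i) (f i))"
proof -
  define N where "N = density lebesgue (\<lambda>x. ennreal (geom_mean m w x))"
  define V where "V x = v x powr (1 / real m)" for x
  define M where "M = density lebesgue (\<lambda>x. ennreal (geom_mean m w x * V x))"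
  have wt: "\<And>i. i \<in> {1..m} \<Longrightarrow> weight (w i)" using assms(2) by (simp add: multilinear_A1_def)
  obtain A B p where "muckenhoupt_pair N M V A B p"
    using multilinear_A1_muckenhoupt_pair[OF assms] unfolding N_def M_def V_def by blast
  then interpret muckenhoupt_pair N M V A B p .
  obtain k where k: "0 < k" and prod_avg: "\<forall>Q\<in>cubes. \<forall>f :: nat \<Rightarrow> real^'n \<Rightarrow> complex.
    (\<forall>i\<in>{1..m}. f i \<in> L1_space (w i)) \<longrightarrow>
    (\<Prod>i=1..m. avg Q (\<lambda>y. ennreal (norm (f i y)))) \<le>
      ennreal (k * (\<Prod>i=1..m. measure (density lebesgue (\<lambda>x. ennreal (norm (f i x) * w i x))) Q) / measure N Q ^ m)"
    using multilinear_A1_prod_avg_le[OF assms(2), where 'b=complex] unfolding N_def by blast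
  show ?thesis
  proof (rule weak_type)
    fix C
    assume C: "0 < C" and weak: "\<And>(G :: (real^'n) set \<Rightarrow> real) T. (\<And>Q. Q \<in> cubes \<Longrightarrow> 0 \<le> G Q) \<Longrightarrow>
      (\<And>Q R. Q \<in> cubes \<Longrightarrow> R \<in> cubes \<Longrightarrow> Q \<subseteq> R \<Longrightarrow> G Q \<le> G R) \<Longrightarrow>
      (\<And>\<C>. finite \<C> \<Longrightarrow> \<C> \<subseteq> cubes \<Longrightarrow> pairwise disjnt \<C> \<Longrightarrow> (\<Sum>Q\<in>\<C>. G Q) \<le> (T::real)) \<Longrightarrow>
      \<exists>E\<in>sets lebesgue. {x. \<exists>Q\<in>cubes. x \<in> Q \<and> V x * measure N Q < G Q} \<subseteq> E \<and>
        emeasure M E \<le> ennreal (C * T)"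
    show ?thesis
    \<comment> \<open>The m-th power of \<open>C * T\<close> is C^m (k/l) L, and the factor
      \<open>l\<close> of the weak norm cancels the 1/l, so neither \<open>l\<close> nor
      \<open>f\<close> enters.\<close>
    proof (intro exI[of _ "C ^ m * k"] allI impI)
      fix f :: "nat \<Rightarrow> real^'n \<Rightarrow> complex"
      assume f: "\<forall>i\<in>{1..m}. f i \<in> L1_space (w i)"
      \<comment> \<open>The null measure outside the index range makes every \<open>F i\<close>
        finite, so finiteness can be used without an index condition.\<close>
      define F where "F i = (if i \<in> {1..m} then density lebesgue (\<lambda>x. ennreal (norm (f i x) * w i x)) else null_measure lebesgue)" for i
      have F_sets: "sets (F i) = sets lebesgue" for i by (simp add: F_def)
      have F_fin: "finite_measure (F i)" for i
      proof (rule finite_measureI)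
        show "emeasure (F i) (space (F i)) \<noteq> \<infinity>"
        proof (cases "i \<in> {1..m}")
          case True
          then have [measurable]: "w i \<in> borel_measurable lebesgue" "f i \<in> borel_measurable lebesgue"
            and "L1_norm (w i) (f i) < \<infinity>"
            using f weight_measurable[OF wt] by (auto simp: L1_space_def)
          then show ?thesis using True by (simp add: F_def emeasure_density L1_norm_def)
        next
          case False
          then show ?thesis unfolding F_def by (subst (1 2) if_not_P) auto
        qed
      qed
      have F_norm: "L1_norm (w i) (f i) = ennreal (measure (F i) UNIV)" if i: "i \<in> {1..m}" for i
      proof -
        have [measurable]: "w i \<in> borel_measurable lebesgue" "f i \<in> borel_measurable lebesgue"
          using f i weight_measurable[OF wt[OF i]] by (auto simp: L1_space_def)
        have "L1_norm (w i) (f i) = emeasure (F i) UNIV"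
          using i by (simp add: F_def emeasure_density L1_norm_def)
        then show ?thesis using finite_measure.emeasure_eq_measure[OF F_fin] by metis
      qed
      define L where "L = (\<Prod>i=1..m. measure (F i) UNIV)"
      have L0: "0 \<le> L" by (simp add: L_def prod_nonneg)
      have L_eq: "(\<Prod>i=1..m. L1_norm (w i) (f i)) = ennreal L"
        by (simp add: L_def F_norm prod_ennreal)
      have bound: "ennreal l * ennreal_powr (\<integral>\<^sup>+x\<in>{x. ennreal l < multi_maximal m f x / ennreal (v x)}.
          ennreal (geom_mean m w x * v x powr (1 / real m)) \<partial>lebesgue) (1 / (1 / real m))
          \<le> ennreal (C ^ m * k) * ennreal L" if l: "0 < l" for l
      proof -
        \<comment> \<open>The m-th root of the right-hand side of v(x) N(Q)^m < (k/l) P, where P is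
          the product of the F_i(Q); the left-hand side becomes V(x) N(Q).\<close>
        define G where "G Q = (k / l) powr (1 / m) * (\<Prod>i=1..m. measure (F i) Q) powr (1 / m)" for Q
        define T where "T = (k / l) powr (1 / m) * L powr (1 / m)"
        have "\<exists>E\<in>sets lebesgue. {x. \<exists>Q\<in>cubes. x \<in> Q \<and> V x * measure N Q < G Q} \<subseteq> E \<and>
            emeasure M E \<le> ennreal (C * T)"
        proof (rule weak)
          show "0 \<le> G Q" for Q by (simp add: G_def)
          show "G Q \<le> G R" if "Q \<in> cubes" "R \<in> cubes" "Q \<subseteq> R" for Q R
            unfolding G_def using that F_sets finite_measure.finite_measure_mono[OF F_fin]
            by (intro mult_left_mono powr_mono2 prod_mono) (auto intro!: prod_nonneg)
          fix \<C> :: "(real^'n) set set"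
          assume \<C>: "finite \<C>" "\<C> \<subseteq> cubes" "pairwise disjnt \<C>"
          have "(\<Sum>Q\<in>\<C>. G Q) = (k / l) powr (1 / m) * (\<Sum>Q\<in>\<C>. (\<Prod>i=1..m. measure (F i) Q) powr (1 / m))"
            by (simp add: G_def sum_distrib_left)
          also have "\<dots> \<le> (k / l) powr (1 / m) * (\<Prod>i=1..m. \<Sum>Q\<in>\<C>. measure (F i) Q) powr (1 / m)"
            using assms(1) \<C> by (intro mult_left_mono sum_root_prod_le) auto
          also have "\<dots> \<le> (k / l) powr (1 / m) * L powr (1 / m)"
            unfolding L_def
          proof (intro mult_left_mono powr_mono2 prod_mono conjI prod_nonneg sum_nonneg)
            fix i
            have "(\<Sum>Q\<in>\<C>. measure (F i) Q) = measure (F i) (\<Union>\<C>)"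
              using \<C> F_sets finite_measure.fmeasurable_eq_sets[OF F_fin, of i]
              by (intro measure_Union'[symmetric]) auto
            also have "\<dots> \<le> measure (F i) UNIV"
              using F_sets finite_measure.finite_measure_mono[OF F_fin, of "\<Union>\<C>" UNIV i] by auto
            finally show "(\<Sum>Q\<in>\<C>. measure (F i) Q) \<le> measure (F i) UNIV" .
          qed auto
          finally show "(\<Sum>Q\<in>\<C>. G Q) \<le> T" by (simp add: T_def)
        qed
        then obtain E where E: "E \<in> sets lebesgue" "emeasure M E \<le> ennreal (C * T)"
          "\<And>x Q. Q \<in> cubes \<Longrightarrow> x \<in> Q \<Longrightarrow> V x * measure N Q < G Q \<Longrightarrow> x \<in> E"
          by blast
        \<comment> \<open>Where v vanishes, the quotient in the level set is governed by the
          convention for division by 0; these points form a null set and are discarded under the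
          integral.\<close>
        have in_E: "x \<in> E" if x: "ennreal l < multi_maximal m f x / ennreal (v x)" and vx: "0 < v x" for x
        proof -
          have "ennreal (l * v x) < multi_maximal m f x"
          proof (rule ccontr)
            assume "\<not> ?thesis"
            then have "multi_maximal m f x / ennreal (v x) \<le> ennreal (l * v x) / ennreal (v x)"
              by (intro divide_right_mono_ennreal) simp
            also have "\<dots> = ennreal l" using vx l by (simp add: divide_ennreal)
            finally show False using x by simp
          qed
          then obtain Q where Q: "Q \<in> cubes" "x \<in> Q"
            and less: "ennreal (l * v x) < (\<Prod>i=1..m. avg Q (\<lambda>y. ennreal (norm (f i y))))"
            unfolding multi_maximal_def less_SUP_iff by blast
          define P where "P = (\<Prod>i=1..m. measure (F i) Q)"
          have P0: "0 \<le> P" by (simp add: P_def prod_nonneg)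
          have P_eq: "(\<Prod>i=1..m. measure (density lebesgue (\<lambda>x. ennreal (norm (f i x) * w i x))) Q) = P"
            unfolding P_def by (intro prod.cong refl) (simp only: F_def if_P)
          have "ennreal (l * v x) < ennreal (k * P / measure N Q ^ m)"
            using less prod_avg[THEN bspec, OF Q(1), THEN spec, THEN mp, OF f] unfolding P_eq
            by (rule less_le_trans)
          then have "l * v x < k * P / measure N Q ^ m"
            using l vx by (simp add: ennreal_less_iff)
          moreover have NQ: "0 < measure N Q" by (rule N_pos[OF Q(1)])
          ultimately have "v x * measure N Q ^ m < k / l * P"
            using l by (simp add: field_simps)
          then have "(v x * measure N Q ^ m) powr (1 / m) < (k / l * P) powr (1 / m)"
            using vx NQ assms(1) by (intro powr_less_mono2) auto
          moreover have "(v x * measure N Q ^ m) powr (1 / m) = V x * measure N Q"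
            using vx NQ assms(1) by (simp add: powr_mult power_powr_inverse V_def)
          moreover have "(k / l * P) powr (1 / m) = (k / l) powr (1 / m) * P powr (1 / m)"
            by (rule powr_mult)
          ultimately have "V x * measure N Q < G Q" by (simp add: G_def P_def)
          then show ?thesis using E(3) Q by blast
        qed
        have "AE x in lebesgue. 0 < v x" using assms(3) by (simp add: weight_def)
        \<comment> \<open>Monotonicity almost everywhere of the nonnegative integral compares the
          two sets without any measurability of the level set.\<close>
        then have "(\<integral>\<^sup>+x\<in>{x. ennreal l < multi_maximal m f x / ennreal (v x)}.
            ennreal (geom_mean m w x * v x powr (1 / real m)) \<partial>lebesgue) \<le>
            (\<integral>\<^sup>+x\<in>E. ennreal (geom_mean m w x * V x) \<partial>lebesgue)"
          by (intro nn_integral_mono_AE, eventually_elim) (auto simp: V_def indicator_def in_E)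
        also have "\<dots> = emeasure M E"
        proof -
          have "(\<lambda>x. ennreal (geom_mean m w x * V x)) \<in> borel_measurable lebesgue"
            using geom_mean_measurable[OF wt] V_measurable by measurable
          then show ?thesis unfolding M_def using E(1) by (simp add: emeasure_density)
        qed
        also note E(2)
        finally have "ennreal_powr (\<integral>\<^sup>+x\<in>{x. ennreal l < multi_maximal m f x / ennreal (v x)}.
            ennreal (geom_mean m w x * v x powr (1 / real m)) \<partial>lebesgue) (1 / (1 / real m))
            \<le> ennreal ((C * T) powr (1 / (1 / real m)))"
          using C assms(1) by (intro ennreal_powr_le) (auto simp: T_def)
        also have "(C * T) powr (1 / (1 / real m)) = C ^ m * (k / l * L)"
        proof -
          have "0 \<le> C * T" using C by (simp add: T_def)
          then have "(C * T) powr (1 / (1 / real m)) = (C * T) ^ m"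
            using assms(1) by (intro power_powr_inverse)
          also have "\<dots> = C ^ m * (((k / l) powr (1 / m)) ^ m * (L powr (1 / m)) ^ m)"
            by (simp only: T_def power_mult_distrib)
          also have "\<dots> = C ^ m * (k / l * L)"
            using k l L0 assms(1) by (simp only: power_powr_inverse divide_nonneg_pos less_imp_le)
          finally show ?thesis .
        qed
        finally have "ennreal l * ennreal_powr (\<integral>\<^sup>+x\<in>{x. ennreal l < multi_maximal m f x / ennreal (v x)}.
            ennreal (geom_mean m w x * v x powr (1 / real m)) \<partial>lebesgue) (1 / (1 / real m))
            \<le> ennreal l * ennreal (C ^ m * (k / l * L))"
          by (rule mult_left_mono) simp
        also have "\<dots> = ennreal (C ^ m * k) * ennreal L"
          using l C k L0 by (simp add: ennreal_mult[symmetric])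
        finally show ?thesis .
      qed
      show "weak_norm (1 / real m) (\<lambda>x. geom_mean m w x * v x powr (1 / real m))
               (\<lambda>x. multi_maximal m f x / ennreal (v x))
             \<le> ennreal (C ^ m * k) * (\<Prod>i=1..m. L1_norm (w i) (f i))"
        unfolding weak_norm_def L_eq by (intro SUP_least bound) simp
    qed
  qed
qed

end
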